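(* Let $K\ge1$ be an integer, $B\in\mathbb R$, and let $r_i$ be the perturbations (depending on $K,B$) defined in the context. Consider the (2,1) random walk $Y$ defined in the context, with $Y_0=2$, and its associated $D$ and $M$. In each case below $c\in(0,\infty)$ denotes a constant not depending on $n$. (i) If $q_i=\frac23+r_i$ (and $p_i=1-q_i$) for all $i\ge2$, then as $n\to\infty$, $$P(M=n,D<\infty)\sim\begin{cases}\dfrac{c}{n\log n\cdots\log_{K-2}n\,\log_{K-1}n\,(\log_Kn)^2}, & B=1,\\[2mm] \dfrac{c}{n\log n\cdots\log_{K-2}n\,(\log_{K-1}n)^B}, & B>1,\\[2mm] \dfrac{c}{n\log n\cdots\log_{K-2}n\,(\log_{K-1}n)^{2-B}}, & B<1.\end{cases}$$ (ii) If $q_i=\frac23-r_i$ (and $p_i=1-q_i$) for all $i\ge2$, then as $n\to\infty$, $$P(M=n,D<\infty)\sim\begin{cases}\dfrac{c}{n^{B+2}}, & K=1,\ B>-1,\\[2mm] \dfrac{c}{n(\log n)^2}, & K=1,\ B=-1,\\[2mm] c\,n^B, & K=1,\ B<-1,\\[2mm] \dfrac{c}{n^3\log n\cdots\log_{K-2}n\,(\log_{K-1}n)^B}, & K>1.\end{cases}$$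
   Context: Iterated logarithms: $\log_0 x=x$ and $\log_k x=\log(\log_{k-1}x)$ for $k\ge1$. The expression $n\log n\cdots\log_{K-2}n$ means $\prod_{j=0}^{K-2}\log_j n$ (equal to $1$ if $K=1$); similarly $n^3\log n\cdots\log_{K-2}n$ means $n^3\prod_{j=1}^{K-2}\log_jn$ for $K\ge2$ (empty product $=1$). Perturbations: for $K\ge1$ and $B\in\mathbb R$, $\Lambda(K,i,B)=\sum_{m=0}^{K-2}\frac{1}{\prod_{j=0}^m\log_j i}+\frac{B}{\prod_{j=0}^{K-1}\log_j i}$ (so $\Lambda(1,i,B)=B/i$, $\Lambda(2,i,B)=\frac1i+\frac{B}{i\log i}$). Let $i_0=\min\{i\ge 1:\log_{K-1}i>0,\ |\Lambda(K,i,B)|<1\}$ and $r_i=\Lambda(K,i,B)/3$ for $i\ge i_0$, $r_i=r_{i_0}$ for $i<i_0$. (2,1) random walk: given $q_k,p_k>0$ with $q_k+p_k=1$ ($k\ge2$), $Y=\{Y_k\}_{k\ge0}$ is the Markov chain on $\{0,1,2,\dots\}$ with $P(Y_{k+1}=1|Y_k=0)=P(Y_{k+1}=2|Y_k=1)=1$ and, for $n\ge2$, $P(Y_{k+1}=n+1|Y_k=n)=q_n$, $P(Y_{k+1}=n-2|Y_k=n)=p_n$. $D=\inf\{k\ge1:Y_k<Y_0\}$ (with $\inf\emptyset=\infty$) and $M=\sup\{Y_k:0\le k\le D\}$. The notation $u_n\sim v_n$ means $u_n/v_n\to1$. *)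

theory Defs
  imports "HOL-Probability.Probability" "HOL-Library.Landau_Symbols" "HOL-Library.Extended_Nat"
begin

definition iter_log :: "nat \<Rightarrow> real \<Rightarrow> real" where
  "iter_log k = ln ^^ k"

definition Lambda :: "nat \<Rightarrow> nat \<Rightarrow> real \<Rightarrow> real" where
  "Lambda K i B =
     (\<Sum>m<K - 1. 1 / (\<Prod>j\<le>m. iter_log j (real i))) + B / (\<Prod>j<K. iter_log j (real i))"

text \<open>
  An iterated logarithm \<open>log\<^sub>k x\<close> makes sense only if all of \<open>log\<^sub>0 x, \<dots>, log\<^bsub>k-1\<^esub> x\<close> are
  positive, whereas \<^const>\<open>ln\<close> is total. So the condition \<open>log\<^bsub>K-1\<^esub> i > 0\<close> is rendered by
  requiring \<open>log\<^sub>j i > 0\<close> for all \<open>j < K\<close>.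
\<close>

definition start_index :: "nat \<Rightarrow> real \<Rightarrow> nat" where
  "start_index K B =
     (LEAST i. 1 \<le> i \<and> (\<forall>j<K. 0 < iter_log j (real i)) \<and> \<bar>Lambda K i B\<bar> < 1)"

text \<open>The maximum freezes the perturbation at its value in the starting index for smaller \<open>i\<close>.\<close>

definition pert :: "nat \<Rightarrow> real \<Rightarrow> nat \<Rightarrow> real" where
  "pert K B i = Lambda K (max i (start_index K B)) B / 3"

definition step_prob :: "(nat \<Rightarrow> real) \<Rightarrow> (nat \<Rightarrow> real) \<Rightarrow> nat \<Rightarrow> nat \<Rightarrow> real" where
  "step_prob q p n m =
     (if n = 0 then (if m = 1 then 1 else 0)
      else if n = 1 then (if m = 2 then 1 else 0)
      else if m = n + 1 then q n
      else if m = n - 2 then p n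
      else 0)"

locale two_one_walk = prob_space N
  for N :: "'a measure" +
  fixes Y :: "nat \<Rightarrow> 'a \<Rightarrow> nat" and q p :: "nat \<Rightarrow> real"
  assumes q_pos: "\<And>k. 2 \<le> k \<Longrightarrow> 0 < q k"
    and p_pos: "\<And>k. 2 \<le> k \<Longrightarrow> 0 < p k"
    and q_plus_p: "\<And>k. 2 \<le> k \<Longrightarrow> q k + p k = 1"
    and random_variable_Y: "\<And>k. random_variable (count_space UNIV) (Y k)"
    and Markov: "\<And>k x y. 0 < \<P>(\<omega> in N. \<forall>j\<le>k. Y j \<omega> = x j) \<Longrightarrow>
      \<P>(\<omega> in N. Y (Suc k) \<omega> = y \<bar> \<forall>j\<le>k. Y j \<omega> = x j) = step_prob q p (x k) y"

text \<open>The following two functionals are applied to the sample path \<open>y\<^sub>0, y\<^sub>1, y\<^sub>2, \<dots>\<close>.\<close>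

definition descent_time :: "(nat \<Rightarrow> nat) \<Rightarrow> enat" where
  "descent_time y = Inf (enat ` {k. 1 \<le> k \<and> y k < y 0})"

definition excursion_max :: "(nat \<Rightarrow> nat) \<Rightarrow> enat" where
  "excursion_max y = Sup ((\<lambda>k. enat (y k)) ` {k. enat k \<le> descent_time y})"

definition max_prob :: "'a measure \<Rightarrow> (nat \<Rightarrow> 'a \<Rightarrow> nat) \<Rightarrow> nat \<Rightarrow> real" where
  "max_prob N Y n =
     \<P>(\<omega> in N. excursion_max (\<lambda>k. Y k \<omega>) = enat n \<and> descent_time (\<lambda>k. Y k \<omega>) < \<infinity>)"

end

theory Submission
  imports Defs
begin

text \<open>
  Let \<open>f\<close> be harmonic for the walk on \<open>{2, 3, \<dots>}\<close> with \<open>f 0 = f 1 = 0\<close> and \<open>f 2 = 1\<close>. The walk moves up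
  by single steps, so optional stopping gives \<open>1 / f n\<close> for the probability of reaching \<open>n\<close> before
  \<open>{0, 1}\<close>, and \<open>P(M = n, D < \<infinity>) = 1 / f n - 1 / f (n + 1)\<close>. The increments of \<open>f\<close> satisfy
  \<open>d n = \<theta> n * (d (n - 1) + d (n - 2))\<close> with \<open>\<theta> n = p n / q n = (1 - s n) / (2 + s n)\<close> and
  \<open>s n = \<plusminus> \<Lambda>(K, n, B)\<close>. After multiplication by \<open>exp (\<Sum>i\<le>n. s i)\<close> this is a recursion by weighted averages
  up to a summable error, so \<open>d n\<close> is asymptotically a constant times \<open>exp (- (\<Sum>i\<le>n. s i))\<close>. Since
  \<open>\<Lambda>\<close> is the derivative of \<open>log\<^sub>1 x + \<dots> + log\<^bsub>K-1\<^esub> x + B log\<^sub>K x\<close>, this is explicit, and \<open>f\<close> itself follows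
  by the Stolz--Cesaro theorem.
\<close>

section \<open>The law of the maximum\<close>

text \<open>For \<open>s = 0\<close> the increments satisfy
  \<open>d n = (d (n - 1) + d (n - 2)) / 2\<close>, with characteristic roots 1 and -1/2. Since
  \<open>r\<close> is \<open>Lambda / 3\<close>, \<open>q = (2 + s) / 3\<close> and
  \<open>p = (1 - s) / 3\<close>, and for a small constant \<open>s\<close> the root near 1 becomes
  \<open>1 - s\<close> up to order \<open>s^2\<close>. This fixes the exponential factor. The root
  near -1/2 contracts, so the differences of the normalised sequence are absolutely summable once
  \<open>s n ^ 2\<close> and \<open>s (n + 1) - s n\<close> are.

  The cases of the theorem come from
  \<open>1 / f n - 1 / f (n + 1) = d n / (f n * f (n + 1))\<close>: a bounded \<open>f\<close>
  leaves the order \<open>d n\<close>, a divergent one gives \<open>d n / f n ^ 2\<close>. For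
  \<open>q = 2/3 + r\<close>, \<open>f\<close> is bounded exactly for B > 1; at B = 1 it grows like
  \<open>iter_log K n\<close>, the source of the extra squared logarithm. For
  \<open>q = 2/3 - r\<close> and K > 1, \<open>d n\<close> is \<open>n\<close> times slowly varying
  factors, so \<open>f n\<close> behaves like \<open>n * d n / 2\<close>, which explains the
  cube.\<close>

lemma excursion_max_iff:
  fixes y :: "nat \<Rightarrow> nat"
  shows "excursion_max y = enat n \<and> descent_time y < \<infinity> \<longleftrightarrow>
    (\<exists>d. 1 \<le> d \<and> y d < y 0 \<and> (\<forall>j<d. y 0 \<le> y j) \<and> (\<forall>k\<le>d. y k \<le> n) \<and> (\<exists>k\<le>d. y k = n))"
proof -
  have time: "descent_time y = enat d" if "1 \<le> d" "y d < y 0" "\<forall>j<d. y 0 \<le> y j" for d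
    unfolding descent_time_def
  proof (rule Inf_eqI)
    fix i assume "i \<in> enat ` {k. 1 \<le> k \<and> y k < y 0}"
    then show "enat d \<le> i" using that by (auto simp: not_less[symmetric])
  qed (use that in auto)
  \<comment> \<open>With a finite descent time the supremum runs over a finite nonempty set and is a
    maximum. The resulting characterisation has only countable quantifiers, which later gives
    measurability.\<close>
  have max: "excursion_max y = enat n \<longleftrightarrow> (\<forall>k\<le>d. y k \<le> n) \<and> (\<exists>k\<le>d. y k = n)"
    if "descent_time y = enat d" for d
  proof -
    define S where "S = (\<lambda>k. enat (y k)) ` {..d}"
    have S: "finite S" "S \<noteq> {}" by (auto simp: S_def)
    have "excursion_max y = Sup S" by (simp add: excursion_max_def that S_def atMost_def)
    also have "\<dots> = Max S" using S by (simp add: Sup_enat_def)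
    finally have "excursion_max y = enat n \<longleftrightarrow> Max S = enat n" by simp
    also have "\<dots> \<longleftrightarrow> enat n \<in> S \<and> (\<forall>s\<in>S. s \<le> enat n)"
      using S by (simp add: Max_eq_iff)
    also have "\<dots> \<longleftrightarrow> (\<forall>k\<le>d. y k \<le> n) \<and> (\<exists>k\<le>d. y k = n)"
      by (auto simp: S_def image_iff)
    finally show ?thesis .
  qed
  have fin: "\<exists>d. 1 \<le> d \<and> y d < y 0 \<and> (\<forall>j<d. y 0 \<le> y j)" if "descent_time y < \<infinity>"
  proof -
    have "{k. 1 \<le> k \<and> y k < y 0} \<noteq> {}"
    proof
      assume "{k. 1 \<le> k \<and> y k < y 0} = {}"
      then have "descent_time y = Inf {}" unfolding descent_time_def by (metis image_empty)
      with that show False by (simp add: top_enat_def)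
    qed
    then obtain k where k: "1 \<le> k \<and> y k < y 0" by auto
    define d where "d = (LEAST k. 1 \<le> k \<and> y k < y 0)"
    have "1 \<le> d \<and> y d < y 0" unfolding d_def using k by (rule LeastI)
    moreover have "y 0 \<le> y j" if "j < d" for j
      using not_less_Least[of j "\<lambda>k. 1 \<le> k \<and> y k < y 0"] that unfolding d_def
      by (cases "j = 0") auto
    ultimately show ?thesis by blast
  qed
  show ?thesis
  proof
    assume L: "excursion_max y = enat n \<and> descent_time y < \<infinity>"
    then obtain d where "1 \<le> d \<and> y d < y 0 \<and> (\<forall>j<d. y 0 \<le> y j)" using fin by blast
    with L max[OF time[of d]] show "\<exists>d. 1 \<le> d \<and> y d < y 0 \<and> (\<forall>j<d. y 0 \<le> y j) \<and> (\<forall>k\<le>d. y k \<le> n) \<and> (\<exists>k\<le>d. y k = n)"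
      by blast
  next
    assume "\<exists>d. 1 \<le> d \<and> y d < y 0 \<and> (\<forall>j<d. y 0 \<le> y j) \<and> (\<forall>k\<le>d. y k \<le> n) \<and> (\<exists>k\<le>d. y k = n)"
    then obtain d where d: "1 \<le> d" "y d < y 0" "\<forall>j<d. y 0 \<le> y j" "(\<forall>k\<le>d. y k \<le> n) \<and> (\<exists>k\<le>d. y k = n)"
      by blast
    show "excursion_max y = enat n \<and> descent_time y < \<infinity>"
      using time[OF d(1-3)] max[OF time[OF d(1-3)]] d(4) by simp
  qed
qed

text \<open>First passage to \<open>n\<close> before \<open>{0, 1}\<close>. Asking
  \<open>y j < n\<close> at the earlier times makes \<open>k\<close> unique, so the events for
  different \<open>k\<close> are disjoint when \<open>prob_hits\<close> sums over
  \<open>k\<close>.\<close>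

definition hits :: "(nat \<Rightarrow> nat) \<Rightarrow> nat \<Rightarrow> bool" where
  "hits y n \<longleftrightarrow> (\<exists>k. y k = n \<and> (\<forall>j<k. 2 \<le> y j \<and> y j < n))"

text \<open>A path that rises by at most one per step cannot jump over \<open>Suc n\<close>. It
  therefore leaves \<open>{2..n}\<close> either by visiting \<open>Suc n\<close>, which is a hit, or
  by dropping below 2, which is the descent. The third hypothesis says that it does leave.\<close>

lemma excursion_max_iff_hits:
  assumes "y 0 = 2" "\<And>k. y (Suc k) \<le> Suc (y k)" "\<not> (\<forall>k. 2 \<le> y k \<and> y k < Suc n)" "2 \<le> n"
  shows "excursion_max y = enat n \<and> descent_time y < \<infinity> \<longleftrightarrow> hits y n \<and> \<not> hits y (Suc n)"
  unfolding excursion_max_iff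
proof
  assume "\<exists>d. 1 \<le> d \<and> y d < y 0 \<and> (\<forall>j<d. y 0 \<le> y j) \<and> (\<forall>k\<le>d. y k \<le> n) \<and> (\<exists>k\<le>d. y k = n)"
  then obtain d k where d: "y d < 2" "\<forall>j<d. 2 \<le> y j" "\<forall>k\<le>d. y k \<le> n" and k: "k \<le> d" "y k = n"
    using assms(1) by auto
  \<comment> \<open>The first visit to \<open>n\<close> turns the bound \<open>y j \<le> n\<close>
    into the strict one in \<open>hits\<close>.\<close>
  define m where "m = (LEAST k. y k = n)"
  have m: "y m = n" "m \<le> k" unfolding m_def using k by (auto intro: LeastI Least_le)
  have ne: "y j \<noteq> n" if "j < m" for j using that not_less_Least unfolding m_def by blast
  have "2 \<le> y j \<and> y j < n" if "j < m" for j
    using d ne[OF that] that m(2) k(1) by (simp add: nat_less_le)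
  then have "hits y n" using m(1) unfolding hits_def by blast
  moreover have "\<not> hits y (Suc n)"
  proof
    assume "hits y (Suc n)"
    then obtain i where i: "y i = Suc n" "\<forall>j<i. 2 \<le> y j" unfolding hits_def by blast
    then show False using d by (metis Suc_n_not_le_n not_le)
  qed
  ultimately show "hits y n \<and> \<not> hits y (Suc n)" ..
next
  assume H: "hits y n \<and> \<not> hits y (Suc n)"
  then obtain h where h: "y h = n" "\<forall>j<h. 2 \<le> y j" unfolding hits_def by blast
  \<comment> \<open>The first exit from \<open>{2..n}\<close>. An exit through \<open>Suc n\<close>
    would be a hit, so this exit is the descent.\<close>
  define d where "d = (LEAST k. \<not> (2 \<le> y k \<and> y k < Suc n))"
  have d1: "\<not> (2 \<le> y d \<and> y d < Suc n)" unfolding d_def using assms(3) by (metis (mono_tags, lifting) LeastI)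
  have d2: "2 \<le> y j \<and> y j < Suc n" if "j < d" for j
    using that not_less_Least unfolding d_def by blast
  have d0: "1 \<le> d" using d1 assms(1,4) by (cases "d = 0") auto
  have "y d \<noteq> Suc n" using H d2 unfolding hits_def by blast
  moreover have "y d \<le> Suc (y (d - 1))" using assms(2)[of "d - 1"] d0 by simp
  moreover have "y (d - 1) < Suc n" using d2[of "d - 1"] d0 by simp
  ultimately have "y d < 2" using d1 by linarith
  moreover from this have "h \<le> d" using h by (meson not_le)
  moreover have "y k \<le> n" if "k \<le> d" for k
    using d2[of k] that \<open>y d < 2\<close> assms(4) by (cases "k = d") auto
  ultimately show "\<exists>d. 1 \<le> d \<and> y d < y 0 \<and> (\<forall>j<d. y 0 \<le> y j) \<and> (\<forall>k\<le>d. y k \<le> n) \<and> (\<exists>k\<le>d. y k = n)"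
    using d0 d2 h(1) assms(1) by (intro exI[of _ d]) auto
qed

text \<open>The step before the first arrival at \<open>Suc n\<close> can start only at
  \<open>n\<close>, so \<open>n\<close> has been visited earlier, and its first visit
  qualifies.\<close>

lemma hits_Suc:
  assumes "y 0 = 2" "\<And>k. y (Suc k) \<le> Suc (y k)" "hits y (Suc n)" "2 \<le> n"
  shows "hits y n"
proof -
  obtain k where k: "y k = Suc n" "\<And>j. j < k \<Longrightarrow> 2 \<le> y j \<and> y j < Suc n"
    using assms(3) by (auto simp: hits_def)
  have "k \<noteq> 0" using k(1) assms(1,4) by (cases k) auto
  then have "y (k - 1) = n" using k(1) k(2)[of "k - 1"] assms(2)[of "k - 1"] by simp
  define m where "m = (LEAST j. y j = n)"
  have m: "y m = n" "m \<le> k - 1"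
    unfolding m_def using \<open>y (k - 1) = n\<close> by (auto intro: LeastI Least_le)
  have "2 \<le> y j \<and> y j < n" if "j < m" for j
  proof -
    have "y j \<noteq> n" using that not_less_Least unfolding m_def by blast
    moreover have "j < k" using that m(2) by linarith
    ultimately show ?thesis using k(2)[of j] by simp
  qed
  then show ?thesis using m(1) by (auto simp: hits_def)
qed

text \<open>\<open>scale_fn (\<lambda>k. p k / q k)\<close> is the harmonic function of the walk that vanishes at 0 and 1,
  and \<open>scale_incr\<close> is its sequence of increments.\<close>

fun scale_incr :: "(nat \<Rightarrow> real) \<Rightarrow> nat \<Rightarrow> real" where
  "scale_incr \<theta> 0 = 0"
| "scale_incr \<theta> (Suc 0) = 1"
| "scale_incr \<theta> (Suc (Suc n)) = \<theta> (Suc (Suc n)) * (scale_incr \<theta> (Suc n) + scale_incr \<theta> n)"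

definition scale_fn :: "(nat \<Rightarrow> real) \<Rightarrow> nat \<Rightarrow> real" where
  "scale_fn \<theta> n = (\<Sum>k<n. scale_incr \<theta> k)"

lemma scale_fn_simps [simp]: "scale_fn \<theta> 0 = 0" "scale_fn \<theta> (Suc 0) = 0" "scale_fn \<theta> 2 = 1"
  by (simp_all add: scale_fn_def numeral_2_eq_2)

lemma scale_fn_Suc: "scale_fn \<theta> (Suc n) = scale_fn \<theta> n + scale_incr \<theta> n"
  by (simp add: scale_fn_def)

lemma scale_incr_pos:
  assumes "\<And>k. 2 \<le> k \<Longrightarrow> 0 < \<theta> k"
  shows "0 < n \<Longrightarrow> 0 < scale_incr \<theta> n"
proof (induction n rule: less_induct)
  case (less n)
  show ?case
  proof (cases "n < 2")
    case True
    with less.prems have "n = Suc 0" by simp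
    then show ?thesis by simp
  next
    case False
    then obtain m where m: "n = Suc (Suc m)" by (metis add_2_eq_Suc le_add_diff_inverse not_less)
    have "0 \<le> scale_incr \<theta> m" using less.IH[of m] m by (cases m) auto
    moreover have "0 < scale_incr \<theta> (Suc m)" using less.IH m by auto
    ultimately show ?thesis using assms[of n] m by simp
  qed
qed

lemma scale_fn_pos:
  assumes "\<And>k. 2 \<le> k \<Longrightarrow> 0 < \<theta> k" and "2 \<le> n"
  shows "0 < scale_fn \<theta> n"
  using assms(2)
proof (induction rule: dec_induct)
  case (step m)
  have "0 < scale_incr \<theta> m" by (rule scale_incr_pos[OF assms(1)]) (use step in auto)
  with step show ?case by (simp add: scale_fn_Suc)
qed simp

section \<open>Path probabilities, the killed walk and hitting probabilities\<close>

context two_one_walk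
begin

lemma Y_measurable [measurable]: "Y k \<in> measurable N (count_space UNIV)"
  by (rule random_variable_Y)

lemma step_prob_sum:
  assumes "2 \<le> x" "x < n"
  shows "(\<Sum>y\<le>n. step_prob q p x y * \<phi> y) = q x * \<phi> (x + 1) + p x * \<phi> (x - 2)"
proof -
  have "(\<Sum>y\<le>n. step_prob q p x y * \<phi> y) = (\<Sum>y\<in>{x + 1, x - 2}. step_prob q p x y * \<phi> y)"
    using assms by (intro sum.mono_neutral_right) (auto simp: step_prob_def)
  also have "\<dots> = q x * \<phi> (x + 1) + p x * \<phi> (x - 2)"
    using assms by (subst sum.insert) (auto simp: step_prob_def)
  finally show ?thesis .
qed

text \<open>The Markov assumption conditions on events of positive probability; the product form
  also covers null histories, where both sides vanish.\<close>

lemma prob_path_step: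
  "prob {\<omega>\<in>space N. Y (Suc k) \<omega> = y \<and> (\<forall>j\<le>k. Y j \<omega> = x j)} =
   prob {\<omega>\<in>space N. \<forall>j\<le>k. Y j \<omega> = x j} * step_prob q p (x k) y"
proof (cases "0 < prob {\<omega>\<in>space N. \<forall>j\<le>k. Y j \<omega> = x j}")
  case True
  from Markov[OF this, of y] True show ?thesis
    by (simp add: cond_prob_def divide_eq_eq mult.commute)
next
  case False
  then have 0: "prob {\<omega>\<in>space N. \<forall>j\<le>k. Y j \<omega> = x j} = 0"
    by (simp add: not_less measure_le_0_iff)
  have "prob {\<omega>\<in>space N. Y (Suc k) \<omega> = y \<and> (\<forall>j\<le>k. Y j \<omega> = x j)} \<le>
      prob {\<omega>\<in>space N. \<forall>j\<le>k. Y j \<omega> = x j}"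
    by (rule finite_measure_mono) auto
  with 0 show ?thesis by (simp add: measure_le_0_iff)
qed

text \<open>The Markov assumption fixes a whole history. Here the past is only confined to a finite
  set, so the finitely many admissible histories are added up.\<close>

lemma prob_history_step:
  assumes "finite I"
  shows "prob {\<omega>\<in>space N. Y (Suc k) \<omega> = y \<and> Y k \<omega> = a \<and> (\<forall>j<k. Y j \<omega> \<in> I)} =
         prob {\<omega>\<in>space N. Y k \<omega> = a \<and> (\<forall>j<k. Y j \<omega> \<in> I)} * step_prob q p a y"
proof -
  \<comment> \<open>Histories are extensional functions on \<open>{..k}\<close>, so distinct ones
    differ at some time up to \<open>k\<close> and their events are disjoint.\<close>
  define P where "P = PiE {..k} (\<lambda>j. if j = k then {a} else I)"
  have finP: "finite P" unfolding P_def using assms by (intro finite_PiE) auto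
  have history: "{\<omega>\<in>space N. Q \<omega> \<and> Y k \<omega> = a \<and> (\<forall>j<k. Y j \<omega> \<in> I)} =
      (\<Union>x\<in>P. {\<omega>\<in>space N. Q \<omega> \<and> (\<forall>j\<le>k. Y j \<omega> = x j)})" for Q
  proof (intro equalityI subsetI)
    fix \<omega> assume w: "\<omega> \<in> {\<omega>\<in>space N. Q \<omega> \<and> Y k \<omega> = a \<and> (\<forall>j<k. Y j \<omega> \<in> I)}"
    define x where "x = restrict (\<lambda>j. Y j \<omega>) {..k}"
    have "x \<in> P" using w unfolding x_def P_def by (auto simp: PiE_iff)
    moreover have "\<forall>j\<le>k. Y j \<omega> = x j" by (simp add: x_def)
    ultimately show "\<omega> \<in> (\<Union>x\<in>P. {\<omega>\<in>space N. Q \<omega> \<and> (\<forall>j\<le>k. Y j \<omega> = x j)})" using w by blast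
  next
    fix \<omega> assume "\<omega> \<in> (\<Union>x\<in>P. {\<omega>\<in>space N. Q \<omega> \<and> (\<forall>j\<le>k. Y j \<omega> = x j)})"
    then obtain x where x: "x \<in> P" "\<omega> \<in> space N" "Q \<omega>" "\<forall>j\<le>k. Y j \<omega> = x j" by blast
    have "x j \<in> (if j = k then {a} else I)" if "j \<le> k" for j
      using x(1) that unfolding P_def by (auto simp: PiE_iff)
    then show "\<omega> \<in> {\<omega>\<in>space N. Q \<omega> \<and> Y k \<omega> = a \<and> (\<forall>j<k. Y j \<omega> \<in> I)}"
      using x by (simp; metis less_imp_le_nat nat_less_le order_refl singletonD)
  qed
  have disj: "disjoint_family_on (\<lambda>x. {\<omega>\<in>space N. Q \<omega> \<and> (\<forall>j\<le>k. Y j \<omega> = x j)}) P" for Q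
  proof (unfold disjoint_family_on_def, intro ballI impI)
    fix x z assume "x \<in> P" "z \<in> P" "x \<noteq> z"
    then have "\<exists>j\<in>{..k}. x j \<noteq> z j" unfolding P_def by (metis PiE_ext)
    then show "{\<omega>\<in>space N. Q \<omega> \<and> (\<forall>j\<le>k. Y j \<omega> = x j)} \<inter> {\<omega>\<in>space N. Q \<omega> \<and> (\<forall>j\<le>k. Y j \<omega> = z j)} = {}"
      by auto
  qed
  have decomp: "prob {\<omega>\<in>space N. Q \<omega> \<and> Y k \<omega> = a \<and> (\<forall>j<k. Y j \<omega> \<in> I)} =
      (\<Sum>x\<in>P. prob {\<omega>\<in>space N. Q \<omega> \<and> (\<forall>j\<le>k. Y j \<omega> = x j)})"
    if [measurable]: "Measurable.pred N Q" for Q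
    unfolding history
  proof (rule finite_measure_finite_Union[OF finP _ disj])
    have "{\<omega>\<in>space N. Q \<omega> \<and> (\<forall>j\<le>k. Y j \<omega> = x j)} \<in> sets N" for x by measurable
    then show "(\<lambda>x. {\<omega>\<in>space N. Q \<omega> \<and> (\<forall>j\<le>k. Y j \<omega> = x j)}) ` P \<subseteq> sets N" by blast
  qed
  have xk: "x k = a" if "x \<in> P" for x
    using PiE_mem[of x "{..k}" "\<lambda>j. if j = k then {a} else I" k] that by (simp add: P_def)
  have "prob {\<omega>\<in>space N. Y (Suc k) \<omega> = y \<and> Y k \<omega> = a \<and> (\<forall>j<k. Y j \<omega> \<in> I)} =
      (\<Sum>x\<in>P. prob {\<omega>\<in>space N. \<forall>j\<le>k. Y j \<omega> = x j} * step_prob q p (x k) y)"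
    using decomp[of "\<lambda>\<omega>. Y (Suc k) \<omega> = y"] by (simp add: prob_path_step)
  also have "\<dots> = (\<Sum>x\<in>P. prob {\<omega>\<in>space N. \<forall>j\<le>k. Y j \<omega> = x j}) * step_prob q p a y"
    unfolding sum_distrib_right by (rule sum.cong) (simp_all only: xk)
  also have "(\<Sum>x\<in>P. prob {\<omega>\<in>space N. \<forall>j\<le>k. Y j \<omega> = x j}) =
      prob {\<omega>\<in>space N. Y k \<omega> = a \<and> (\<forall>j<k. Y j \<omega> \<in> I)}"
    using decomp[of "\<lambda>\<omega>. True"] by simp
  finally show ?thesis .
qed

text \<open>The walk killed on leaving \<open>{2..<n}\<close>; a killed particle is counted at the moment of leaving only.\<close>

definition killed :: "nat \<Rightarrow> nat \<Rightarrow> nat \<Rightarrow> real" where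
  "killed n k x = prob {\<omega>\<in>space N. Y k \<omega> = x \<and> (\<forall>j<k. Y j \<omega> \<in> {2..<n})}"

lemma killed_nonneg: "0 \<le> killed n k x"
  by (simp add: killed_def)

lemma killed_Suc: "killed n (Suc k) y = (\<Sum>x\<in>{2..<n}. killed n k x * step_prob q p x y)"
proof -
  have "killed n (Suc k) y =
     prob (\<Union>x\<in>{2..<n}. {\<omega>\<in>space N. Y (Suc k) \<omega> = y \<and> Y k \<omega> = x \<and> (\<forall>j<k. Y j \<omega> \<in> {2..<n})})"
    unfolding killed_def by (rule arg_cong[of _ _ prob]) (auto simp: less_Suc_eq)
  also have "\<dots> = (\<Sum>x\<in>{2..<n}. prob {\<omega>\<in>space N. Y (Suc k) \<omega> = y \<and> Y k \<omega> = x \<and> (\<forall>j<k. Y j \<omega> \<in> {2..<n})})"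
    by (intro finite_measure_finite_Union) (auto simp: disjoint_family_on_def)
  also have "\<dots> = (\<Sum>x\<in>{2..<n}. killed n k x * step_prob q p x y)"
    unfolding killed_def by (intro sum.cong prob_history_step refl finite_atLeastLessThan)
  finally show ?thesis .
qed

text \<open>Moves the transition step from the mass to the test function. It serves both a function
  that decreases on average and the harmonic function. The sum may stop at \<open>n\<close> because
  a step from below \<open>n\<close> ends at most there.\<close>

lemma killed_Suc_sum:
  "(\<Sum>y\<le>n. killed n (Suc k) y * \<phi> y) =
   (\<Sum>x\<in>{2..<n}. killed n k x * (q x * \<phi> (x + 1) + p x * \<phi> (x - 2)))"
proof -
  have "(\<Sum>y\<le>n. killed n (Suc k) y * \<phi> y) =
      (\<Sum>y\<le>n. \<Sum>x\<in>{2..<n}. killed n k x * (step_prob q p x y * \<phi> y))"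
    unfolding killed_Suc sum_distrib_right mult.assoc ..
  also have "\<dots> = (\<Sum>x\<in>{2..<n}. killed n k x * (\<Sum>y\<le>n. step_prob q p x y * \<phi> y))"
    unfolding sum_distrib_left by (rule sum.swap)
  also have "\<dots> = (\<Sum>x\<in>{2..<n}. killed n k x * (q x * \<phi> (x + 1) + p x * \<phi> (x - 2)))"
    by (intro sum.cong arg_cong2[of _ _ _ _ "(*)"] step_prob_sum refl) auto
  finally show ?thesis .
qed

text \<open>For large \<open>R\<close>, the function \<open>R\<^sup>n - R\<^sup>x\<close> decreases on average by at least 1 in each step,
  so the expected time spent in \<open>{2..<n}\<close> is finite.\<close>

lemma killed_tendsto_0: "(\<lambda>k. \<Sum>x\<in>{2..<n}. killed n k x) \<longlonglongrightarrow> 0"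
proof -
  \<comment> \<open>Inserting 1 keeps the minimum defined for an empty interval and gives
    \<open>m \<le> 1\<close>.\<close>
  define m where "m = Min (insert 1 (q ` {2..<n}))"
  have "0 < m" unfolding m_def using q_pos by (subst Min_gr_iff) auto
  have m: "m \<le> 1" "\<And>x. x \<in> {2..<n} \<Longrightarrow> m \<le> q x"
    unfolding m_def by (rule Min_le; simp)+
  \<comment> \<open>This makes \<open>q x * R \<ge> 2\<close>, so the upward step alone contributes
    at least \<open>2 * R ^ x\<close> to the mean of the new power, a gain of at least
    \<open>R ^ x \<ge> 1\<close>.\<close>
  define R where "R = 2 / m"
  have R: "1 \<le> R" "\<And>x. x \<in> {2..<n} \<Longrightarrow> 2 \<le> q x * R"
    using m \<open>0 < m\<close> by (auto simp: R_def field_simps)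
  define v where "v = (\<lambda>x. R ^ n - R ^ x)"
  have v: "0 \<le> v x" if "x \<le> n" for x using R(1) that by (simp add: v_def power_increasing)
  have drift: "q x * v (x + 1) + p x * v (x - 2) \<le> v x - 1" if x: "x \<in> {2..<n}" for x
  proof -
    have "1 \<le> R ^ x" using R(1) by simp
    also have "R ^ x \<le> (q x * R - 1) * R ^ x"
      using R(2)[OF x] \<open>1 \<le> R ^ x\<close> by simp
    finally have "1 \<le> q x * R ^ (x + 1) - R ^ x" by (simp add: algebra_simps)
    moreover have "0 \<le> p x * R ^ (x - 2)" using p_pos[of x] x R(1) by auto
    moreover have "q x * v (x + 1) + p x * v (x - 2) =
        (q x + p x) * R ^ n - q x * R ^ (x + 1) - p x * R ^ (x - 2)"
      unfolding v_def by (simp add: algebra_simps)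
    ultimately show ?thesis using q_plus_p[of x] x by (simp add: v_def)
  qed
  define V where "V k = (\<Sum>x\<in>{2..<n}. killed n k x * v x)" for k
  define S where "S k = (\<Sum>x\<in>{2..<n}. killed n k x)" for k
  have V: "0 \<le> V k" for k unfolding V_def using v killed_nonneg by (auto intro!: sum_nonneg)
  have "V (Suc k) \<le> V k - S k" for k
  proof -
    have "V (Suc k) \<le> (\<Sum>x\<le>n. killed n (Suc k) x * v x)"
      unfolding V_def using v killed_nonneg by (intro sum_mono2) auto
    also have "\<dots> = (\<Sum>x\<in>{2..<n}. killed n k x * (q x * v (x + 1) + p x * v (x - 2)))"
      by (rule killed_Suc_sum)
    also have "\<dots> \<le> (\<Sum>x\<in>{2..<n}. killed n k x * (v x - 1))"
      using drift killed_nonneg by (intro sum_mono mult_left_mono) auto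
    also have "\<dots> = V k - S k" by (simp add: V_def S_def algebra_simps sum_subtractf)
    finally show ?thesis .
  qed
  then have "(\<Sum>k<m. S k) \<le> V 0 - V m" for m
  proof (induction m)
    case (Suc m)
    from Suc.IH[OF Suc.prems] Suc.prems[of m] show ?case by simp
  qed simp
  then have "(\<Sum>k<m. S k) \<le> V 0" for m using V[of m] by (meson diff_le_eq le_add_same_cancel1 order_trans)
  moreover have "0 \<le> S k" for k unfolding S_def using killed_nonneg by (auto intro!: sum_nonneg)
  ultimately have "summable S" by (intro summableI_nonneg_bounded)
  then show ?thesis unfolding S_def by (rule summable_LIMSEQ_zero)
qed

text \<open>An upward step from \<open>x\<close> gains the increment at \<open>x\<close>, a downward
  step loses the two preceding increments; the recursion of \<open>scale_incr\<close> is the balance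
  of the two means.\<close>

lemma scale_fn_harmonic:
  assumes "2 \<le> x"
  shows "q x * scale_fn (\<lambda>k. p k / q k) (x + 1) + p x * scale_fn (\<lambda>k. p k / q k) (x - 2) =
    scale_fn (\<lambda>k. p k / q k) x"
proof -
  obtain m where m: "x = Suc (Suc m)" using assms by (metis add_2_eq_Suc le_add_diff_inverse)
  define \<theta> where "\<theta> = (\<lambda>k. p k / q k)"
  have q: "q x * scale_incr \<theta> x = p x * (scale_incr \<theta> (Suc m) + scale_incr \<theta> m)"
    using q_pos[OF assms] by (simp add: m \<theta>_def)
  have "q x * scale_fn \<theta> (Suc x) + p x * scale_fn \<theta> m =
      (q x + p x) * scale_fn \<theta> x + q x * scale_incr \<theta> x -
      p x * (scale_incr \<theta> (Suc m) + scale_incr \<theta> m)"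
    by (simp add: m scale_fn_Suc algebra_simps)
  also have "\<dots> = scale_fn \<theta> x" using q_plus_p[OF assms] by (simp add: q)
  finally show ?thesis by (simp add: \<theta>_def m)
qed

lemma killed_0:
  assumes "AE \<omega> in N. Y 0 \<omega> = 2"
  shows "killed n 0 x = (if x = 2 then 1 else 0)"
proof (cases "x = 2")
  case True
  then show ?thesis using assms by (simp add: killed_def prob_eq_1)
next
  case False
  have "AE \<omega> in N. \<not> Y 0 \<omega> = x" using assms False by auto
  then show ?thesis using False by (simp add: killed_def prob_eq_0)
qed

lemma hits_measurable [measurable]: "Measurable.pred N (\<lambda>\<omega>. hits (\<lambda>k. Y k \<omega>) n)"
  unfolding hits_def by measurable

text \<open>The mean of \<open>f\<close> is conserved: mass stopped at 0 or 1 has value 0, mass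
  stopped at \<open>n\<close> has value \<open>f n\<close>, and the part \<open>I\<close> still
  inside vanishes in the limit because \<open>f\<close> is bounded on the finite interval. For
  \<open>2 < n\<close> all mass starts inside, with value \<open>f 2 = 1\<close>.\<close>

lemma prob_hits:
  assumes "AE \<omega> in N. Y 0 \<omega> = 2" "2 < n"
  shows "\<P>(\<omega> in N. hits (\<lambda>k. Y k \<omega>) n) = 1 / scale_fn (\<lambda>k. p k / q k) n"
proof -
  define f where "f = scale_fn (\<lambda>k. p k / q k)"
  have f: "0 < f x" if "2 \<le> x" for x
    unfolding f_def by (rule scale_fn_pos) (use q_pos p_pos that in auto)
  define I where "I k = (\<Sum>x\<in>{2..<n}. killed n k x * f x)" for k
  have sum_split: "(\<Sum>x\<le>n. killed n k x * f x) = I k + killed n k n * f n" for k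
  proof -
    have "{..n} = insert n ({2..<n} \<union> {0, 1})" using assms(2) by auto
    then show ?thesis using assms(2) by (simp add: I_def f_def)
  qed
  have step: "I (Suc k) + killed n (Suc k) n * f n = I k" for k
  proof -
    have "I (Suc k) + killed n (Suc k) n * f n =
      (\<Sum>x\<in>{2..<n}. killed n k x * (q x * f (x + 1) + p x * f (x - 2)))"
      using sum_split killed_Suc_sum by metis
    also have "\<dots> = I k" unfolding I_def f_def
      by (intro sum.cong arg_cong2[of _ _ _ _ "(*)"] scale_fn_harmonic refl) auto
    finally show ?thesis .
  qed
  have I_eq: "I k + (\<Sum>j\<le>k. killed n j n) * f n = I 0 + killed n 0 n * f n" for k
  proof (induction k)
    case (Suc k)
    then show ?case using step[of k] by (simp add: distrib_right)
  qed simp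
  have I0: "I 0 = 1"
  proof -
    have "I 0 = (\<Sum>x\<in>{2..<n}. if x = 2 then f 2 else 0)"
      unfolding I_def by (intro sum.cong) (auto simp: killed_0[OF assms(1)])
    then show ?thesis using assms(2) by (simp add: f_def)
  qed
  have "(\<lambda>k. (\<Sum>x\<in>{2..<n}. killed n k x) * Max (f ` {2..<n})) \<longlonglongrightarrow> 0 * Max (f ` {2..<n})"
    by (intro tendsto_mult_right killed_tendsto_0)
  then have lim: "(\<lambda>k. (\<Sum>x\<in>{2..<n}. killed n k x) * Max (f ` {2..<n})) \<longlonglongrightarrow> 0" by simp
  have "0 \<le> I k" for k
    unfolding I_def using killed_nonneg f by (intro sum_nonneg mult_nonneg_nonneg) (auto simp: less_imp_le)
  moreover have "I k \<le> (\<Sum>x\<in>{2..<n}. killed n k x) * Max (f ` {2..<n})" for k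
    unfolding I_def sum_distrib_right using killed_nonneg by (intro sum_mono mult_left_mono) auto
  ultimately have "I \<longlonglongrightarrow> 0"
    by (intro tendsto_sandwich[OF _ _ tendsto_const lim]) simp_all
  then have "(\<lambda>k. (1 - I k) / f n) \<longlonglongrightarrow> (1 - 0) / f n"
    using f[of n] assms(2) by (intro tendsto_intros) auto
  moreover have "(1 - I k) / f n = (\<Sum>j\<le>k. killed n j n)" for k
    using I_eq[of k] f[of n] assms I0 by (simp add: killed_0[OF assms(1)] field_simps)
  ultimately have "(\<lambda>k. killed n k n) sums (1 / f n)" by (simp add: sums_def_le)
  moreover have "(\<lambda>k. killed n k n) sums prob (\<Union>k. {\<omega>\<in>space N. Y k \<omega> = n \<and> (\<forall>j<k. Y j \<omega> \<in> {2..<n})})"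
    unfolding killed_def
  proof (rule finite_measure_UNION)
    show "disjoint_family (\<lambda>k. {\<omega>\<in>space N. Y k \<omega> = n \<and> (\<forall>j<k. Y j \<omega> \<in> {2..<n})})"
      unfolding disjoint_family_on_def
    proof (intro ballI impI)
      fix i j :: nat assume "i \<noteq> j"
      then consider "i < j" | "j < i" by linarith
      then show "{\<omega>\<in>space N. Y i \<omega> = n \<and> (\<forall>l<i. Y l \<omega> \<in> {2..<n})} \<inter>
        {\<omega>\<in>space N. Y j \<omega> = n \<and> (\<forall>l<j. Y l \<omega> \<in> {2..<n})} = {}"
        by cases auto
    qed
    have "{\<omega>\<in>space N. Y k \<omega> = n \<and> (\<forall>j<k. Y j \<omega> \<in> {2..<n})} \<in> sets N" for k
      unfolding atLeastLessThan_iff by measurable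
    then show "range (\<lambda>k. {\<omega>\<in>space N. Y k \<omega> = n \<and> (\<forall>j<k. Y j \<omega> \<in> {2..<n})}) \<subseteq> sets N" by blast
  qed
  moreover have "(\<Union>k. {\<omega>\<in>space N. Y k \<omega> = n \<and> (\<forall>j<k. Y j \<omega> \<in> {2..<n})}) =
      {\<omega>\<in>space N. hits (\<lambda>k. Y k \<omega>) n}"
    by (auto simp: hits_def)
  ultimately show ?thesis unfolding f_def using sums_unique2 by metis
qed

text \<open>Staying inside forever means surviving up to every time \<open>k\<close>, and the
  surviving mass tends to 0.\<close>

lemma AE_leaves_interval: "AE \<omega> in N. \<not> (\<forall>k. 2 \<le> Y k \<omega> \<and> Y k \<omega> < n)"
proof -
  have le: "prob {\<omega>\<in>space N. \<forall>k. 2 \<le> Y k \<omega> \<and> Y k \<omega> < n} \<le> (\<Sum>x\<in>{2..<n}. killed n k x)" for k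
  proof -
    have "prob {\<omega>\<in>space N. \<forall>k. 2 \<le> Y k \<omega> \<and> Y k \<omega> < n} \<le>
       prob (\<Union>x\<in>{2..<n}. {\<omega>\<in>space N. Y k \<omega> = x \<and> (\<forall>j<k. Y j \<omega> \<in> {2..<n})})"
      by (intro finite_measure_mono) auto
    also have "\<dots> = (\<Sum>x\<in>{2..<n}. killed n k x)"
      unfolding killed_def by (intro finite_measure_finite_Union) (auto simp: disjoint_family_on_def)
    finally show ?thesis .
  qed
  have "prob {\<omega>\<in>space N. \<forall>k. 2 \<le> Y k \<omega> \<and> Y k \<omega> < n} \<le> 0"
    by (rule tendsto_lowerbound[OF killed_tendsto_0[of n]]) (simp_all add: le)
  then have "prob {\<omega>\<in>space N. \<forall>k. 2 \<le> Y k \<omega> \<and> Y k \<omega> < n} = 0" by (simp add: measure_le_0_iff)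
  then show ?thesis by (subst (asm) prob_eq_0) (auto elim!: AE_mp)
qed

text \<open>Jumps upward by more than one have step probability 0. The Markov assumption yields null
  events per complete history, and there are only countably many pairs of a history and a next
  state.\<close>

lemma AE_upward_skip_free: "AE \<omega> in N. \<forall>k. Y (Suc k) \<omega> \<le> Suc (Y k \<omega>)"
proof (subst AE_all_countable, intro allI)
  fix k
  have "AE \<omega> in N. \<forall>y. \<forall>x\<in>PiE {..k} (\<lambda>_. UNIV). step_prob q p (x k) y = 0 \<longrightarrow>
      \<not> (Y (Suc k) \<omega> = y \<and> (\<forall>j\<le>k. Y j \<omega> = x j))"
  proof (subst AE_all_countable, intro allI, subst AE_ball_countable)
    show "\<forall>x\<in>PiE {..k} (\<lambda>_. UNIV). AE \<omega> in N. step_prob q p (x k) y = 0 \<longrightarrow>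
        \<not> (Y (Suc k) \<omega> = y \<and> (\<forall>j\<le>k. Y j \<omega> = x j))" for y
    proof
      fix x :: "nat \<Rightarrow> nat"
      show "AE \<omega> in N. step_prob q p (x k) y = 0 \<longrightarrow> \<not> (Y (Suc k) \<omega> = y \<and> (\<forall>j\<le>k. Y j \<omega> = x j))"
      proof (cases "step_prob q p (x k) y = 0")
        case True
        then have "prob {\<omega>\<in>space N. Y (Suc k) \<omega> = y \<and> (\<forall>j\<le>k. Y j \<omega> = x j)} = 0"
          by (simp add: prob_path_step)
        then show ?thesis by (subst (asm) prob_eq_0) (auto elim!: AE_mp)
      qed simp
    qed
  qed (auto intro: countable_PiE)
  then show "AE \<omega> in N. Y (Suc k) \<omega> \<le> Suc (Y k \<omega>)"
  proof eventually_elim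
    case (elim \<omega>)
    define x where "x = restrict (\<lambda>j. Y j \<omega>) {..k}"
    have "x \<in> PiE {..k} (\<lambda>_. UNIV)" "\<forall>j\<le>k. Y j \<omega> = x j" by (auto simp: x_def)
    with elim have "step_prob q p (x k) (Y (Suc k) \<omega>) \<noteq> 0" by blast
    then have "step_prob q p (Y k \<omega>) (Y (Suc k) \<omega>) \<noteq> 0" by (simp add: x_def)
    then show ?case by (auto simp: step_prob_def split: if_splits)
  qed
qed

text \<open>Almost surely the event is \<open>H n - H (Suc n)\<close>, and \<open>H (Suc n)\<close>
  lies in \<open>H n\<close> up to a null set, so the hitting probabilities subtract.\<close>

lemma max_prob_eq:
  assumes "AE \<omega> in N. Y 0 \<omega> = 2" "2 < n"
  shows "max_prob N Y n =
    1 / scale_fn (\<lambda>k. p k / q k) n - 1 / scale_fn (\<lambda>k. p k / q k) (Suc n)"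
proof -
  define H where "H n = {\<omega>\<in>space N. hits (\<lambda>k. Y k \<omega>) n}" for n
  have [measurable]: "H n \<in> sets N" for n unfolding H_def by measurable
  have "max_prob N Y n = prob (H n - H (Suc n))"
    unfolding max_prob_def
  proof (rule measure_eq_AE)
    show "AE \<omega> in N. \<omega> \<in> {\<omega>\<in>space N. excursion_max (\<lambda>k. Y k \<omega>) = enat n \<and> descent_time (\<lambda>k. Y k \<omega>) < \<infinity>}
        \<longleftrightarrow> \<omega> \<in> H n - H (Suc n)"
      using assms(1) AE_upward_skip_free AE_leaves_interval[of "Suc n"] AE_space
    proof eventually_elim
      case (elim \<omega>)
      then show ?case
        using excursion_max_iff_hits[of "\<lambda>k. Y k \<omega>" n] assms(2) by (simp add: H_def)
    qed
    \<comment> \<open>A relation between two coordinates is a countable union over their values;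
      this handles the comparisons of \<open>y d\<close> and \<open>y j\<close> with
      \<open>y 0\<close>.\<close>
    have [measurable]: "Measurable.pred N (\<lambda>\<omega>. R (Y i \<omega>) (Y j \<omega>))" for R :: "nat \<Rightarrow> nat \<Rightarrow> bool" and i j
    proof -
      have "Measurable.pred N (\<lambda>\<omega>. \<exists>a b. R a b \<and> Y i \<omega> = a \<and> Y j \<omega> = b)" by measurable
      then show ?thesis by simp
    qed
    show "{\<omega>\<in>space N. excursion_max (\<lambda>k. Y k \<omega>) = enat n \<and> descent_time (\<lambda>k. Y k \<omega>) < \<infinity>} \<in> sets N"
      unfolding excursion_max_iff by measurable
  qed auto
  also have "\<dots> = prob (H n) - prob (H n \<inter> H (Suc n))"
    by (rule finite_measure_Diff') measurable
  also have "prob (H n \<inter> H (Suc n)) = prob (H (Suc n))"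
  proof (rule measure_eq_AE)
    show "AE \<omega> in N. \<omega> \<in> H n \<inter> H (Suc n) \<longleftrightarrow> \<omega> \<in> H (Suc n)"
      using assms(1) AE_upward_skip_free AE_space
    proof eventually_elim
      case (elim \<omega>)
      then show ?case using hits_Suc[of "\<lambda>k. Y k \<omega>" n] assms(2) by (auto simp: H_def)
    qed
  qed auto
  finally show ?thesis using prob_hits[OF assms(1)] assms(2) by (simp add: H_def)
qed

end

section \<open>Perturbed averaging recursions\<close>

text \<open>Summing the inequality bounds a partial sum \<open>S\<close> by
  \<open>w 0 + r * S + suminf g\<close>, and \<open>r < 1\<close> allows solving for
  \<open>S\<close>.\<close>

lemma summable_of_contraction:
  fixes w g :: "nat \<Rightarrow> real"
  assumes "\<And>n. 0 \<le> w n" "\<And>n. 0 \<le> g n" "summable g" "r < 1" "0 \<le> r"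
    and "\<And>n. w (Suc n) \<le> r * w n + g n"
  shows "summable w"
proof (rule summableI_nonneg_bounded)
  fix n
  have "(\<Sum>k<Suc m. w k) \<le> w 0 + r * (\<Sum>k<m. w k) + (\<Sum>k<m. g k)" for m
  proof (induction m)
    case (Suc m)
    then show ?case using assms(6)[of m] by (simp add: algebra_simps)
  qed simp
  from this[of n] have "(\<Sum>k<n. w k) \<le> w 0 + r * (\<Sum>k<n. w k) + (\<Sum>k<n. g k)"
    using assms(1)[of n] by simp
  also have "(\<Sum>k<n. g k) \<le> suminf g" using assms by (intro sum_le_suminf) auto
  finally have "(1 - r) * (\<Sum>k<n. w k) \<le> w 0 + suminf g" by (simp add: algebra_simps)
  then show "(\<Sum>k<n. w k) \<le> (w 0 + suminf g) / (1 - r)"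
    using assms(4) by (simp add: field_simps)
qed (fact assms(1))

text \<open>For \<open>a + b = 1\<close> each difference is \<open>- b n\<close> times the previous
  one, a contraction. A summable defect keeps \<open>u\<close> bounded and adds a summable error, so
  the differences stay absolutely summable. The limit is positive because the minimum of two
  neighbours loses at most a factor \<open>1 - e n\<close> per step.\<close>

lemma second_order_recurrence_tendsto_pos:
  fixes u a b :: "nat \<Rightarrow> real"
  assumes u: "\<And>n. 0 < u n" and ab: "\<And>n. 0 \<le> a n" "\<And>n. 0 \<le> b n"
    and rec: "\<And>n. u (Suc (Suc n)) = a n * u (Suc n) + b n * u n"
    and summ: "summable (\<lambda>n. \<bar>a n + b n - 1\<bar>)"
    and b: "\<And>n. b n \<le> \<beta>" "\<beta> < 1"
  shows "\<exists>c>0. u \<longlonglongrightarrow> c"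
proof -
  define e where "e n = \<bar>a n + b n - 1\<bar>" for n
  have e: "0 \<le> e n" "a n + b n \<le> 1 + e n" "1 - e n \<le> a n + b n" for n by (auto simp: e_def)
  have summ_e: "summable e" using summ by (simp add: e_def[abs_def])
  \<comment> \<open>The larger of two neighbours grows by at most
    \<open>1 + e n \<le> exp (e n)\<close> per step, which bounds \<open>u\<close>.\<close>
  define M where "M n = max (u n) (u (Suc n))" for n
  have M0: "0 < M n" for n using u[of n] by (simp add: M_def)
  have M: "M (Suc n) \<le> exp (e n) * M n" for n
  proof -
    have "u (Suc (Suc n)) \<le> a n * M n + b n * M n"
      unfolding rec using ab by (intro add_mono mult_left_mono) (auto simp: M_def)
    also have "\<dots> \<le> (1 + e n) * M n"
      unfolding distrib_right[symmetric] using e M0[of n] by (intro mult_right_mono) auto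
    also have "\<dots> \<le> exp (e n) * M n" using M0[of n] by (intro mult_right_mono) auto
    finally have "u (Suc (Suc n)) \<le> exp (e n) * M n" .
    moreover have "1 * M n \<le> exp (e n) * M n" using e M0[of n] by (intro mult_right_mono) auto
    ultimately show ?thesis by (auto simp: M_def)
  qed
  have "M n \<le> M 0 * exp (\<Sum>k<n. e k)" for n
  proof (induction n)
    case (Suc n)
    have "M (Suc n) \<le> exp (e n) * M n" by (rule M)
    also have "\<dots> \<le> exp (e n) * (M 0 * exp (\<Sum>k<n. e k))" using Suc by simp
    finally show ?case by (simp add: exp_add mult_ac)
  qed simp
  also have "M 0 * exp (\<Sum>k<n. e k) \<le> M 0 * exp (suminf e)" for n
    using M0[of 0] summ_e e by (intro mult_left_mono) (auto intro!: sum_le_suminf)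
  finally have u_le: "u n \<le> M 0 * exp (suminf e)" for n by (simp add: M_def)
  define C where "C = M 0 * exp (suminf e)"
  have C: "u n \<le> C" for n using u_le by (simp add: C_def)
  have "summable (\<lambda>n. \<bar>u (Suc n) - u n\<bar>)"
  proof (rule summable_of_contraction[where r = \<beta> and g = "\<lambda>n. e n * C"])
    show "0 \<le> \<beta>" using ab b order_trans by blast
    show "0 \<le> e n * C" for n using e C[of 0] u[of 0] by simp
    show "summable (\<lambda>n. e n * C)" using summ_e by (rule summable_mult2)
    fix n
    have "u (Suc (Suc n)) - u (Suc n) = - b n * (u (Suc n) - u n) + (a n + b n - 1) * u (Suc n)"
      by (simp add: rec algebra_simps)
    then have "\<bar>u (Suc (Suc n)) - u (Suc n)\<bar> \<le>
        \<bar>- b n * (u (Suc n) - u n)\<bar> + \<bar>(a n + b n - 1) * u (Suc n)\<bar>"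
      by linarith
    also have "\<dots> = b n * \<bar>u (Suc n) - u n\<bar> + e n * u (Suc n)"
      using ab u[of "Suc n"] by (simp add: abs_mult e_def)
    also have "\<dots> \<le> \<beta> * \<bar>u (Suc n) - u n\<bar> + e n * C"
      using b C e by (intro add_mono mult_right_mono mult_left_mono) auto
    finally show "\<bar>u (Suc (Suc n)) - u (Suc n)\<bar> \<le> \<beta> * \<bar>u (Suc n) - u n\<bar> + e n * C" .
  qed (use b in auto)
  then have "summable (\<lambda>n. u (Suc n) - u n)" by (rule summable_rabs_cancel)
  then have "(\<lambda>n. \<Sum>k<n. u (Suc k) - u k) \<longlonglongrightarrow> (\<Sum>k. u (Suc k) - u k)" by (rule summable_LIMSEQ)
  then have "(\<lambda>n. (u n - u 0) + u 0) \<longlonglongrightarrow> (\<Sum>k. u (Suc k) - u k) + u 0"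
    unfolding sum_lessThan_telescope by (intro tendsto_intros)
  then obtain c where c: "u \<longlonglongrightarrow> c" by auto
  \<comment> \<open>A product of factors \<open>1 - e k\<close> is at least 1 minus the sum of the
    \<open>e k\<close>; a tail sum below 1/2 thus preserves half of the minimum at
    \<open>n0\<close>.\<close>
  obtain n0 where n0: "(\<Sum>k. e (k + n0)) < 1/2"
    using suminf_exist_split[OF _ summ_e, of "1/2"] suminf_nonneg[OF summable_ignore_initial_segment[OF summ_e]] e
    by (metis (no_types, lifting) abs_of_nonneg half_gt_zero_iff order_refl real_norm_def zero_less_one)
  define m where "m n = min (u n) (u (Suc n))" for n
  have m0: "0 < m n" for n using u by (simp add: m_def)
  have m: "(1 - e n) * m n \<le> m (Suc n)" for n
  proof -
    have "(1 - e n) * m n \<le> (a n + b n) * m n" using e m0[of n] by (intro mult_right_mono) auto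
    also have "\<dots> \<le> u (Suc (Suc n))"
      unfolding rec distrib_right using ab by (intro add_mono mult_left_mono) (auto simp: m_def)
    finally have "(1 - e n) * m n \<le> u (Suc (Suc n))" .
    moreover have "(1 - e n) * m n \<le> 1 * m n" using e m0[of n] by (intro mult_right_mono) auto
    ultimately show ?thesis by (auto simp: m_def)
  qed
  define E where "E j = (\<Sum>k<j. e (k + n0))" for j
  have E: "0 \<le> E j" "E j < 1/2" for j
  proof -
    show "0 \<le> E j" unfolding E_def using e by (intro sum_nonneg) auto
    have "E j \<le> (\<Sum>k. e (k + n0))" unfolding E_def
      using e summ_e by (intro sum_le_suminf) (auto simp: summable_iff_shift)
    with n0 show "E j < 1/2" by simp
  qed
  have lower: "(1 - E j) * m n0 \<le> m (j + n0)" for j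
  proof (induction j)
    case (Suc j)
    have ej: "E (Suc j) = E j + e (j + n0)" by (simp add: E_def)
    have "(1 - E (Suc j)) * m n0 \<le> ((1 - e (j + n0)) * (1 - E j)) * m n0"
      using m0[of n0] E(1)[of j] e(1)[of "j + n0"] ej
      by (intro mult_right_mono) (auto simp: algebra_simps)
    also have "\<dots> = (1 - e (j + n0)) * ((1 - E j) * m n0)" by simp
    also have "\<dots> \<le> (1 - e (j + n0)) * m (j + n0)"
      using Suc E(1)[of j] E(2)[of "Suc j"] ej by (intro mult_left_mono) auto
    also have "\<dots> \<le> m (Suc j + n0)" using m by simp
    finally show ?case .
  qed (simp add: E_def)
  have "m n0 / 2 \<le> u (j + n0)" for j
  proof -
    have "1/2 * m n0 \<le> (1 - E j) * m n0" using E(2)[of j] m0[of n0] by (intro mult_right_mono) auto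
    also have "\<dots> \<le> m (j + n0)" by (rule lower)
    finally show ?thesis by (simp add: m_def)
  qed
  moreover have "(\<lambda>j. u (j + n0)) \<longlonglongrightarrow> c" using c by (rule LIMSEQ_ignore_initial_segment)
  ultimately have "m n0 / 2 \<le> c" by (meson LIMSEQ_le_const)
  then have "0 < c" using m0[of n0] by simp
  then show ?thesis using c by blast
qed

lemma abs_exp_minus_one_minus_le:
  fixes x :: real
  assumes "\<bar>x\<bar> \<le> 1"
  shows "\<bar>exp x - 1 - x\<bar> \<le> x\<^sup>2"
proof -
  have "exp x \<le> 1 + x + x\<^sup>2"
  proof (cases "0 \<le> x")
    case True
    then show ?thesis using exp_bound assms by simp
  next
    case False
    define y where "y = - x"
    have y: "0 < y" using False by (simp add: y_def)
    have "exp x = 1 / exp y" by (simp add: y_def exp_minus inverse_eq_divide)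
    also have "\<dots> \<le> 1 / (1 + y)" using y by (intro divide_left_mono) (auto intro: add_pos_pos)
    also have "\<dots> \<le> 1 - y + y\<^sup>2"
    proof -
      have "(1 - y + y\<^sup>2) * (1 + y) = 1 + y ^ 3" by (simp add: algebra_simps power2_eq_square power3_eq_cube)
      then show ?thesis using y by (simp add: divide_le_eq)
    qed
    finally show ?thesis by (simp add: y_def)
  qed
  then show ?thesis using exp_ge_add_one_self[of x] by linarith
qed

text \<open>With \<open>u n = scale_incr \<theta> n * exp (\<Sum>i\<le>n. s i)\<close>, the recursion of the increments becomes one in which
  \<open>u (n + 2)\<close> is almost an average of \<open>u (n + 1)\<close> and \<open>u n\<close>. This bounds the deviation of the total weight from 1.\<close>

lemma coefficient_sum_error:
  fixes s t :: real
  assumes "\<bar>s\<bar> \<le> 1/4" "\<bar>t\<bar> \<le> 1/4"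
  defines "\<theta> \<equiv> (1 - s) / (2 + s)"
  shows "\<bar>\<theta> * exp s + \<theta> * exp (s + t) - 1\<bar> \<le> \<bar>s - t\<bar> + 8 * s\<^sup>2 + 4 * t\<^sup>2"
proof -
  define f1 where "f1 = exp s - 1 - s"
  define f2 where "f2 = exp (s + t) - 1 - (s + t)"
  have f1: "\<bar>f1\<bar> \<le> s\<^sup>2" unfolding f1_def using assms by (intro abs_exp_minus_one_minus_le) auto
  have "\<bar>f2\<bar> \<le> (s + t)\<^sup>2" unfolding f2_def using assms by (intro abs_exp_minus_one_minus_le) auto
  also have "\<dots> \<le> 2 * s\<^sup>2 + 2 * t\<^sup>2"
    using zero_le_power2[of "s - t"] by (simp add: power2_sum power2_diff)
  finally have f2: "\<bar>f2\<bar> \<le> 2 * s\<^sup>2 + 2 * t\<^sup>2" .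
  have st: "\<bar>s * t\<bar> \<le> s\<^sup>2 / 2 + t\<^sup>2 / 2"
    using zero_le_power2[of "s - t"] zero_le_power2[of "s + t"] by (simp add: power2_sum power2_diff abs_le_iff)
  have rest: "\<bar>(1 - s) * (f1 + f2)\<bar> \<le> 5/4 * (3 * s\<^sup>2 + 2 * t\<^sup>2)"
    unfolding abs_mult using assms f1 f2 by (intro mult_mono) auto
  \<comment> \<open>Multiplying by \<open>2 + s\<close> clears the denominator. With both
    exponentials replaced by their linear parts, the first-order terms cancel except for
    \<open>t - s\<close>.\<close>
  have expand: "(2 + s) * (\<theta> * exp s + \<theta> * exp (s + t) - 1) =
      (t - s) - 2 * s\<^sup>2 - s * t + (1 - s) * (f1 + f2)"
  proof -
    have "(2 + s) * \<theta> = 1 - s" using assms by (simp add: \<theta>_def)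
    have "(2 + s) * (\<theta> * exp s + \<theta> * exp (s + t) - 1) =
        ((2 + s) * \<theta>) * exp s + ((2 + s) * \<theta>) * exp (s + t) - (2 + s)"
      by (simp only: algebra_simps)
    also have "\<dots> = (1 - s) * exp s + (1 - s) * exp (s + t) - (2 + s)"
      unfolding \<open>(2 + s) * \<theta> = 1 - s\<close> ..
    also have "\<dots> = (t - s) - 2 * s\<^sup>2 - s * t + (1 - s) * (f1 + f2)"
      by (simp add: f1_def f2_def algebra_simps power2_eq_square)
    finally show ?thesis .
  qed
  have "\<bar>(2 + s) * (\<theta> * exp s + \<theta> * exp (s + t) - 1)\<bar> \<le>
      \<bar>t - s\<bar> + 2 * s\<^sup>2 + \<bar>s * t\<bar> + \<bar>(1 - s) * (f1 + f2)\<bar>"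
    unfolding expand using zero_le_power2[of s] by linarith
  \<comment> \<open>The weights of the two squares add up to \<open>2 + 1/2 + 15/4\<close> and
    \<open>1/2 + 5/2\<close>, rounded up to 8 and 4.\<close>
  also have "\<dots> \<le> \<bar>t - s\<bar> + 8 * s\<^sup>2 + 4 * t\<^sup>2"
    using add_mono[OF rest st] zero_le_power2[of s] zero_le_power2[of t] by argo
  finally have "\<bar>(2 + s) * (\<theta> * exp s + \<theta> * exp (s + t) - 1)\<bar> \<le> \<bar>s - t\<bar> + 8 * s\<^sup>2 + 4 * t\<^sup>2"
    by (simp add: abs_minus_commute)
  moreover have "1 * \<bar>\<theta> * exp s + \<theta> * exp (s + t) - 1\<bar> \<le> \<bar>(2 + s) * (\<theta> * exp s + \<theta> * exp (s + t) - 1)\<bar>"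
    unfolding abs_mult using assms by (intro mult_right_mono) auto
  ultimately show ?thesis by simp
qed

text \<open>The two summability hypotheses are what makes the bound of
  \<open>coefficient_sum_error\<close> summable.\<close>

lemma scale_incr_asymp:
  fixes s :: "nat \<Rightarrow> real"
  assumes pos: "\<And>k. 2 \<le> k \<Longrightarrow> 0 < \<theta> k"
    and \<theta>: "\<forall>\<^sub>F n in sequentially. \<theta> n = (1 - s n) / (2 + s n)"
    and sq: "summable (\<lambda>n. (s n)\<^sup>2)" and var: "summable (\<lambda>n. \<bar>s (Suc n) - s n\<bar>)"
  shows "\<exists>c>0. (\<lambda>n. scale_incr \<theta> n * exp (\<Sum>k\<le>n. s k)) \<longlonglongrightarrow> c"
proof -
  have "(\<lambda>n. sqrt ((s n)\<^sup>2)) \<longlonglongrightarrow> sqrt 0" by (intro tendsto_intros summable_LIMSEQ_zero sq)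
  then have s0: "s \<longlonglongrightarrow> 0" by (simp add: tendsto_rabs_zero_iff)
  \<comment> \<open>The coefficient of the older term tends to 1/2, so 3/4 can serve as contraction
    bound.\<close>
  have "(\<lambda>n. (1 - s (Suc n)) / (2 + s (Suc n)) * exp (s (Suc n) + s n)) \<longlonglongrightarrow> (1 - 0) / (2 + 0) * exp (0 + 0)"
    by (intro tendsto_intros s0 LIMSEQ_Suc[OF s0]) auto
  then have lt: "\<forall>\<^sub>F n in sequentially. (1 - s (Suc n)) / (2 + s (Suc n)) * exp (s (Suc n) + s n) < 3/4"
    by (rule order_tendstoD(2)) simp
  have "\<forall>\<^sub>F n in sequentially. \<bar>s n\<bar> < 1/4"
    using tendsto_rabs_zero[OF s0] by (rule order_tendstoD(2)) simp
  from eventually_conj[OF \<theta> eventually_conj[OF lt this]] obtain N where N: "\<And>n. N \<le> n \<Longrightarrow> \<theta> n = (1 - s n) / (2 + s n)"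
      "\<And>n. N \<le> n \<Longrightarrow> (1 - s (Suc n)) / (2 + s (Suc n)) * exp (s (Suc n) + s n) < 3/4"
      "\<And>n. N \<le> n \<Longrightarrow> \<bar>s n\<bar> < 1/4"
    unfolding eventually_sequentially by blast
  \<comment> \<open>Shifting past \<open>N\<close> makes the conditions valid for every index, and
    \<open>n0 > 0\<close> avoids \<open>scale_incr \<theta> 0 = 0\<close>, which would break
    positivity.\<close>
  define n0 where "n0 = Suc N"
  define u where "u n = scale_incr \<theta> n * exp (\<Sum>k\<le>n. s k)" for n
  define a where "a n = \<theta> (Suc (Suc (n + n0))) * exp (s (Suc (Suc (n + n0))))" for n
  define b where "b n = \<theta> (Suc (Suc (n + n0))) * exp (s (Suc (Suc (n + n0))) + s (Suc (n + n0)))" for n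
  have "\<exists>c>0. (\<lambda>n. u (n + n0)) \<longlonglongrightarrow> c"
  proof (rule second_order_recurrence_tendsto_pos[of "\<lambda>n. u (n + n0)" a b "3/4"])
    show "0 < u (n + n0)" for n
      unfolding u_def by (intro mult_pos_pos scale_incr_pos pos) (auto simp: n0_def)
    show "0 \<le> a n" "0 \<le> b n" for n using pos[of "Suc (Suc (n + n0))"] by (simp_all add: a_def b_def)
    show "u (Suc (Suc n) + n0) = a n * u (Suc n + n0) + b n * u (n + n0)" for n
    proof -
      define m where "m = n + n0"
      have "u (Suc (Suc m)) = \<theta> (Suc (Suc m)) * (scale_incr \<theta> (Suc m) + scale_incr \<theta> m) *
          exp ((\<Sum>k\<le>m. s k) + s (Suc m) + s (Suc (Suc m)))"
        by (simp add: u_def)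
      also have "\<dots> = a n * u (Suc m) + b n * u m"
        unfolding u_def a_def b_def m_def[symmetric] sum.atMost_Suc exp_add by (simp only: algebra_simps)
      finally show ?thesis by (simp add: m_def)
    qed
    show "b n \<le> 3/4" for n
      using N(2)[of "Suc (n + n0)"] N(1)[of "Suc (Suc (n + n0))"] by (simp add: b_def n0_def less_imp_le)
    define g where "g n = \<bar>s (Suc n) - s n\<bar> + 8 * (s (Suc n))\<^sup>2 + 4 * (s n)\<^sup>2" for n
    have "summable (\<lambda>n. (s (Suc n))\<^sup>2)" using summable_ignore_initial_segment[OF sq, of 1] by simp
    then have "summable g" unfolding g_def using sq var by (intro summable_add summable_mult)
    then have "summable (\<lambda>n. g (n + Suc n0))" by (rule summable_ignore_initial_segment)
    then show "summable (\<lambda>n. \<bar>a n + b n - 1\<bar>)"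
    proof (rule summable_comparison_test')
      fix n :: nat
      show "norm \<bar>a n + b n - 1\<bar> \<le> g (n + Suc n0)"
      proof -
        define m where "m = n + n0"
        have "N \<le> Suc m" "N \<le> Suc (Suc m)" by (simp_all add: m_def n0_def)
        then have "\<theta> (Suc (Suc m)) = (1 - s (Suc (Suc m))) / (2 + s (Suc (Suc m)))"
            "\<bar>s (Suc m)\<bar> \<le> 1/4" "\<bar>s (Suc (Suc m))\<bar> \<le> 1/4"
          using N(1,3) by (blast intro: less_imp_le)+
        moreover from this(2,3) have "\<bar>(1 - s (Suc (Suc m))) / (2 + s (Suc (Suc m))) * exp (s (Suc (Suc m))) +
            (1 - s (Suc (Suc m))) / (2 + s (Suc (Suc m))) * exp (s (Suc (Suc m)) + s (Suc m)) - 1\<bar> \<le> g (Suc m)"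
          unfolding g_def by (intro coefficient_sum_error)
        ultimately show ?thesis by (simp add: a_def b_def m_def[symmetric])
      qed
    qed
  qed simp
  then obtain c where "0 < c" "(\<lambda>n. u (n + n0)) \<longlonglongrightarrow> c" by blast
  moreover from this(2) have "u \<longlonglongrightarrow> c" by (rule LIMSEQ_offset)
  ultimately show ?thesis unfolding u_def[abs_def] by blast
qed

section \<open>Iterated logarithms\<close>

lemma iter_log_0 [simp]: "iter_log 0 x = x" by (simp add: iter_log_def)

lemma iter_log_Suc: "iter_log (Suc k) x = ln (iter_log k x)" by (simp add: iter_log_def)

lemma filterlim_iter_log: "filterlim (iter_log k) at_top at_top"
proof (induction k)
  case 0
  have "iter_log 0 = (\<lambda>x. x)" by (simp add: fun_eq_iff)
  then show ?case by (simp add: filterlim_ident)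
next
  case (Suc k)
  have "iter_log (Suc k) = (\<lambda>x. ln (iter_log k x))" by (simp add: fun_eq_iff iter_log_Suc)
  then show ?case using filterlim_compose[OF ln_at_top Suc] by simp
qed

lemma eventually_iter_log_ge: "\<forall>\<^sub>F x in at_top. \<forall>j\<le>k. (c::real) \<le> iter_log j x"
proof -
  have "\<forall>\<^sub>F x in at_top. \<forall>j\<in>{..k}. c \<le> iter_log j x"
    by (intro eventually_ball_finite ballI) (auto intro: filterlim_at_top[THEN iffD1, rule_format] filterlim_iter_log)
  then show ?thesis by (simp add: Ball_def)
qed

lemma DERIV_iter_log:
  assumes "\<And>j. j < k \<Longrightarrow> 0 < iter_log j x"
  shows "(iter_log k has_real_derivative 1 / (\<Prod>j<k. iter_log j x)) (at x)"
  using assms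
proof (induction k)
  case 0
  have "iter_log 0 = (\<lambda>x. x)" by (simp add: fun_eq_iff)
  then show ?case by simp
next
  case (Suc k)
  have eq: "iter_log (Suc k) = (\<lambda>x. ln (iter_log k x))" by (simp add: fun_eq_iff iter_log_Suc)
  have "((\<lambda>x. ln (iter_log k x)) has_real_derivative
      1 / iter_log k x * (1 / (\<Prod>j<k. iter_log j x))) (at x)"
    using Suc by (intro DERIV_chain'[OF _ DERIV_ln_divide]) auto
  then show ?case unfolding eq by (simp add: mult_ac)
qed

lemma iter_log_mono:
  assumes "\<And>j. j < k \<Longrightarrow> 1 \<le> iter_log j x" "x \<le> y"
  shows "iter_log k x \<le> iter_log k y"
  using assms(1)
proof (induction k)
  case (Suc k)
  have "iter_log k x \<le> iter_log k y" "1 \<le> iter_log k x" using Suc by auto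
  then show ?case by (simp add: iter_log_Suc)
qed (simp add: assms(2))

text \<open>The mean value theorem puts \<open>F (n + 1) - F n\<close> between
  \<open>f (n + 1)\<close> and \<open>f n\<close>, so its distance from \<open>f (n + 1)\<close> is
  at most the drop \<open>f n - f (n + 1)\<close>. The drops telescope, and \<open>f\<close> is
  bounded below by 0. The limit in the second claim is the analogue of Euler's constant.\<close>

lemma DERIV_eventually_antimono_sum:
  fixes F f :: "real \<Rightarrow> real"
  assumes deriv: "\<And>x. real N \<le> x \<Longrightarrow> (F has_real_derivative f x) (at x)"
    and anti: "\<And>x y. real N \<le> x \<Longrightarrow> x \<le> y \<Longrightarrow> f y \<le> f x"
    and nonneg: "\<And>x. real N \<le> x \<Longrightarrow> 0 \<le> f x"
  shows "summable (\<lambda>n. \<bar>f (real (Suc n)) - f (real n)\<bar>)"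
    and "convergent (\<lambda>n. (\<Sum>k\<le>n. f (real k)) - F (real n))"
proof -
  define t where "t n = f (real n) - f (real (Suc n))" for n
  have t: "0 \<le> t n" if "N \<le> n" for n using anti that by (simp add: t_def)
  have summ_t: "summable (\<lambda>n. t (n + N))"
  proof (rule summableI_nonneg_bounded)
    fix n
    have "(\<Sum>k<n. t (k + N)) = f (real N) - f (real (n + N))"
      by (induction n) (simp_all add: t_def)
    then show "(\<Sum>k<n. t (k + N)) \<le> f (real N)" using nonneg[of "real (n + N)"] by simp
  qed (simp add: t)
  also have "(\<lambda>n. t (n + N)) = (\<lambda>n. \<bar>f (real (Suc (n + N))) - f (real (n + N))\<bar>)"
    using t[of "_ + N"] by (simp add: t_def fun_eq_iff)
  finally have "summable (\<lambda>n. \<bar>f (real (Suc (n + N))) - f (real (n + N))\<bar>)" .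
  then show "summable (\<lambda>n. \<bar>f (real (Suc n)) - f (real n)\<bar>)"
    by (rule summable_iff_shift[THEN iffD1])
  define D where "D n = f (real (Suc n)) - (F (real (Suc n)) - F (real n))" for n
  have "\<bar>D n\<bar> \<le> t n" if "N \<le> n" for n
  proof -
    have "\<exists>z. real n < z \<and> z < real (Suc n) \<and> F (real (Suc n)) - F (real n) = (real (Suc n) - real n) * f z"
      using that by (intro MVT2 deriv) auto
    then obtain z where z: "real n < z" "z < real (Suc n)" "F (real (Suc n)) - F (real n) = f z" by auto
    have "f z \<le> f (real n)" "f (real (Suc n)) \<le> f z" using z that by (auto intro!: anti)
    then show ?thesis unfolding D_def t_def z(3) by linarith
  qed
  then have "summable (\<lambda>n. D (n + N))"
    by (intro summable_comparison_test'[OF summ_t, of 0]) auto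
  then have "summable D" by (rule summable_iff_shift[THEN iffD1])
  then have "(\<lambda>n. \<Sum>k<n. D k) \<longlonglongrightarrow> suminf D" by (rule summable_LIMSEQ)
  then have "(\<lambda>n. (\<Sum>k<n. D k) + (f 0 - F 0)) \<longlonglongrightarrow> suminf D + (f 0 - F 0)"
    by (intro tendsto_intros)
  moreover have "(\<Sum>k<n. D k) + (f 0 - F 0) = (\<Sum>k\<le>n. f (real k)) - F (real n)" for n
    by (induction n) (simp_all add: D_def)
  ultimately show "convergent (\<lambda>n. (\<Sum>k\<le>n. f (real k)) - F (real n))"
    by (auto simp: convergent_def)
qed

text \<open>The derivative of \<open>iter_log (Suc m)\<close> where the logarithms are positive;
  \<open>Lambda\<close> is a linear combination of these weights.\<close>

definition iter_log_weight :: "nat \<Rightarrow> real \<Rightarrow> real" where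
  "iter_log_weight m x = 1 / (\<Prod>j\<le>m. iter_log j x)"

lemma iter_log_weight_sum:
  shows "summable (\<lambda>n. \<bar>iter_log_weight m (real (Suc n)) - iter_log_weight m (real n)\<bar>)"
    and "convergent (\<lambda>n. (\<Sum>k\<le>n. iter_log_weight m (real k)) - iter_log (Suc m) (real n))"
proof -
  have "\<forall>\<^sub>F n in sequentially. \<forall>j\<le>m. 1 \<le> iter_log j (real n)"
    by (rule eventually_compose_filterlim[OF eventually_iter_log_ge filterlim_real_sequentially])
  \<comment> \<open>From \<open>N\<close> on all logarithms involved are at least 1 and increasing,
    so the weight is positive and decreasing.\<close>
  then obtain N where N: "\<And>j. j \<le> m \<Longrightarrow> 1 \<le> iter_log j (real N)"
    unfolding eventually_sequentially by blast
  have ge: "1 \<le> iter_log j x" if "j \<le> m" "real N \<le> x" for j x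
    using iter_log_mono[of j "real N" x] N[of j] N that by fastforce
  have deriv: "(iter_log (Suc m) has_real_derivative iter_log_weight m x) (at x)" if "real N \<le> x" for x
    unfolding iter_log_weight_def lessThan_Suc_atMost[symmetric]
    by (intro DERIV_iter_log) (use ge that in \<open>fastforce simp: less_Suc_eq_le\<close>)
  have pos: "0 < (\<Prod>j\<le>m. iter_log j x)" if "real N \<le> x" for x
    by (intro prod_pos) (use ge that in fastforce)
  have nonneg: "0 \<le> iter_log_weight m x" if "real N \<le> x" for x
    using pos[OF that] by (simp add: iter_log_weight_def)
  have anti: "iter_log_weight m y \<le> iter_log_weight m x" if "real N \<le> x" "x \<le> y" for x y
  proof -
    have "(\<Prod>j\<le>m. iter_log j x) \<le> (\<Prod>j\<le>m. iter_log j y)"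
    proof (intro prod_mono conjI)
      fix j assume "j \<in> {..m}"
      then show "0 \<le> iter_log j x" "iter_log j x \<le> iter_log j y"
        using ge[of _ x] that iter_log_mono[of j x y] by fastforce+
    qed
    then show ?thesis unfolding iter_log_weight_def
      using pos[of x] pos[of y] that by (intro divide_left_mono mult_pos_pos) auto
  qed
  show "summable (\<lambda>n. \<bar>iter_log_weight m (real (Suc n)) - iter_log_weight m (real n)\<bar>)"
    "convergent (\<lambda>n. (\<Sum>k\<le>n. iter_log_weight m (real k)) - iter_log (Suc m) (real n))"
    using DERIV_eventually_antimono_sum[OF deriv anti nonneg] by blast+
qed

text \<open>The factor for \<open>j = 0\<close> is \<open>x\<close>, and the others are eventually
  at least 1.\<close>

lemma eventually_iter_log_weight_le:
  "\<forall>\<^sub>F x in at_top. 0 \<le> iter_log_weight m x \<and> iter_log_weight m x \<le> 1 / x"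
  using eventually_iter_log_ge[of m 1] eventually_gt_at_top[of 0]
proof eventually_elim
  case (elim x)
  have "{..m} = insert 0 {1..m}" by auto
  then have "(\<Prod>j\<le>m. iter_log j x) = x * (\<Prod>j=1..m. iter_log j x)" by simp
  moreover have "1 \<le> (\<Prod>j=1..m. iter_log j x)" using elim by (intro prod_ge_1) auto
  ultimately have "x \<le> (\<Prod>j\<le>m. iter_log j x)" using elim by simp
  then show ?case using elim unfolding iter_log_weight_def
    by (auto intro!: divide_left_mono mult_pos_pos)
qed

lemma one_div_tendsto_0_at_top: "((\<lambda>x::real. 1 / x) \<longlongrightarrow> 0) at_top"
  by (rule tendsto_divide_0[OF tendsto_const filterlim_at_top_imp_at_infinity[OF filterlim_ident]])

lemma iter_log_weight_tendsto_0: "(iter_log_weight m \<longlongrightarrow> 0) at_top"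
proof (rule tendsto_sandwich[OF _ _ tendsto_const one_div_tendsto_0_at_top])
  show "\<forall>\<^sub>F x in at_top. 0 \<le> iter_log_weight m x" "\<forall>\<^sub>F x in at_top. iter_log_weight m x \<le> 1 / x"
    using eventually_iter_log_weight_le[of m] by (auto elim: eventually_mono)
qed

text \<open>\<^const>\<open>Lambda\<close> for \<open>K = k + 1\<close> as a function of a real argument, and a primitive of it.\<close>

definition Lambda_real :: "nat \<Rightarrow> real \<Rightarrow> real \<Rightarrow> real" where
  "Lambda_real k B x = (\<Sum>m<k. iter_log_weight m x) + B * iter_log_weight k x"

definition Lambda_int :: "nat \<Rightarrow> real \<Rightarrow> real \<Rightarrow> real" where
  "Lambda_int k B x = (\<Sum>m<k. iter_log (Suc m) x) + B * iter_log (Suc k) x"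

lemma Lambda_eq_Lambda_real: "Lambda (Suc k) i B = Lambda_real k B (real i)"
  by (simp add: Lambda_def Lambda_real_def iter_log_weight_def lessThan_Suc_atMost)

lemma Lambda_real_tendsto_0: "(Lambda_real k B \<longlongrightarrow> 0) at_top"
proof -
  have "((\<lambda>x. (\<Sum>m<k. iter_log_weight m x) + B * iter_log_weight k x) \<longlongrightarrow> (\<Sum>m<k. 0) + B * 0) at_top"
    by (intro tendsto_intros iter_log_weight_tendsto_0)
  then show ?thesis by (simp add: Lambda_real_def[abs_def])
qed

lemma DERIV_iter_log_Suc:
  "\<forall>\<^sub>F x in at_top. (iter_log (Suc m) has_real_derivative iter_log_weight m x) (at x)"
  using eventually_iter_log_ge[of m 1]
proof eventually_elim
  case (elim x)
  then have "0 < iter_log j x" if "j < Suc m" for j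
    using that by (meson less_Suc_eq_le less_le_trans zero_less_one)
  then show ?case unfolding iter_log_weight_def lessThan_Suc_atMost[symmetric] by (rule DERIV_iter_log)
qed

lemma DERIV_Lambda_int:
  "\<forall>\<^sub>F x in at_top. (Lambda_int k B has_real_derivative Lambda_real k B x) (at x)"
proof -
  have "\<forall>\<^sub>F x in at_top. \<forall>m\<in>{..k}. (iter_log (Suc m) has_real_derivative iter_log_weight m x) (at x)"
    by (intro eventually_ball_finite ballI DERIV_iter_log_Suc) simp
  then show ?thesis
  proof eventually_elim
    case (elim x)
    have "((\<lambda>x. (\<Sum>m<k. iter_log (Suc m) x) + B * iter_log (Suc k) x) has_real_derivative
        (\<Sum>m<k. iter_log_weight m x) + B * iter_log_weight k x) (at x)"
      using elim by (intro DERIV_add DERIV_sum DERIV_cmult) auto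
    then show ?case by (simp add: Lambda_real_def Lambda_int_def[abs_def])
  qed
qed

text \<open>\<open>exp\<close> lowers the index of an iterated logarithm by one, so the sum of
  logarithms turns into the products seen in the theorem.\<close>

lemma exp_Lambda_int:
  "\<forall>\<^sub>F x in at_top. exp (Lambda_int k B x) = (\<Prod>j<k. iter_log j x) * iter_log k x powr B"
  using eventually_iter_log_ge[of k 1]
proof eventually_elim
  case (elim x)
  then have "exp (iter_log (Suc j) x) = iter_log j x" if "j \<le> k" for j
    using that by (subst iter_log_Suc) (simp add: less_le_trans[OF zero_less_one])
  moreover have "iter_log k x \<noteq> 0" using elim by fastforce
  ultimately show ?case
    by (simp add: Lambda_int_def exp_add exp_sum powr_def iter_log_Suc)
qed

lemma summable_Lambda_real_sq: "summable (\<lambda>n. (Lambda_real k B (real n))\<^sup>2)"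
proof -
  define C where "C = real k + \<bar>B\<bar>"
  have "\<forall>\<^sub>F x in at_top. \<forall>m\<in>{..k}. 0 \<le> iter_log_weight m x \<and> iter_log_weight m x \<le> 1 / x"
    by (intro eventually_ball_finite ballI eventually_iter_log_weight_le) simp
  then have "\<forall>\<^sub>F x in at_top. \<bar>Lambda_real k B x\<bar> \<le> C * (1 / x)"
  proof eventually_elim
    case (elim x)
    have "\<bar>Lambda_real k B x\<bar> \<le> (\<Sum>m<k. \<bar>iter_log_weight m x\<bar>) + \<bar>B\<bar> * \<bar>iter_log_weight k x\<bar>"
      unfolding Lambda_real_def abs_mult[symmetric] by (intro order_trans[OF abs_triangle_ineq] add_mono sum_abs order_refl)
    also have "\<dots> \<le> (\<Sum>m<k. 1 / x) + \<bar>B\<bar> * (1 / x)"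
      using elim by (intro add_mono sum_mono mult_left_mono) auto
    also have "\<dots> = C * (1 / x)" by (simp add: C_def add_divide_distrib)
    finally show ?case .
  qed
  then have "\<forall>\<^sub>F n in sequentially. \<bar>Lambda_real k B (real n)\<bar> \<le> C * (1 / real n)"
    by (rule eventually_compose_filterlim[OF _ filterlim_real_sequentially])
  then have "\<forall>\<^sub>F n in sequentially. norm ((Lambda_real k B (real n))\<^sup>2) \<le> C\<^sup>2 * (1 / (real n)\<^sup>2)"
  proof eventually_elim
    case (elim n)
    then have "\<bar>Lambda_real k B (real n)\<bar>\<^sup>2 \<le> (C * (1 / real n))\<^sup>2" by (intro power_mono) auto
    then show ?case by (simp add: power_divide)
  qed
  moreover have "summable (\<lambda>n. C\<^sup>2 * (1 / (real n)\<^sup>2))"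
    using inverse_power_summable[of 2, where 'a=real] by (intro summable_mult) (simp add: inverse_eq_divide)
  ultimately show ?thesis by (rule summable_comparison_test_ev)
qed

text \<open>A negative \<open>B\<close> mixes signs, so the comparison of sum and primitive is made
  for each weight separately and then combined linearly.\<close>

lemma Lambda_real_sum:
  shows "summable (\<lambda>n. \<bar>Lambda_real k B (real (Suc n)) - Lambda_real k B (real n)\<bar>)"
    and "convergent (\<lambda>n. (\<Sum>i\<le>n. Lambda_real k B (real i)) - Lambda_int k B (real n))"
proof -
  let ?w = "\<lambda>m n. iter_log_weight m (real n)"
  have "summable (\<lambda>n. (\<Sum>m<k. \<bar>?w m (Suc n) - ?w m n\<bar>) + \<bar>B\<bar> * \<bar>?w k (Suc n) - ?w k n\<bar>)"
    by (intro summable_add summable_sum summable_mult iter_log_weight_sum)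
  then show "summable (\<lambda>n. \<bar>Lambda_real k B (real (Suc n)) - Lambda_real k B (real n)\<bar>)"
  proof (rule summable_comparison_test')
    fix n :: nat
    have "Lambda_real k B (real (Suc n)) - Lambda_real k B (real n) =
        (\<Sum>m<k. ?w m (Suc n) - ?w m n) + B * (?w k (Suc n) - ?w k n)"
      unfolding Lambda_real_def sum_subtractf right_diff_distrib by linarith
    also have "\<bar>\<dots>\<bar> \<le> (\<Sum>m<k. \<bar>?w m (Suc n) - ?w m n\<bar>) + \<bar>B\<bar> * \<bar>?w k (Suc n) - ?w k n\<bar>"
      unfolding abs_mult[symmetric] by (intro order_trans[OF abs_triangle_ineq] add_mono sum_abs order_refl)
    finally show "norm \<bar>Lambda_real k B (real (Suc n)) - Lambda_real k B (real n)\<bar> \<le>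
        (\<Sum>m<k. \<bar>?w m (Suc n) - ?w m n\<bar>) + \<bar>B\<bar> * \<bar>?w k (Suc n) - ?w k n\<bar>" by simp
  qed
  obtain l where l: "(\<lambda>n. (\<Sum>i\<le>n. ?w m i) - iter_log (Suc m) (real n)) \<longlonglongrightarrow> l m" for m
    using iter_log_weight_sum(2) unfolding convergent_def by metis
  have "(\<lambda>n. (\<Sum>m<k. (\<Sum>i\<le>n. ?w m i) - iter_log (Suc m) (real n)) +
      B * ((\<Sum>i\<le>n. ?w k i) - iter_log (Suc k) (real n))) \<longlonglongrightarrow> (\<Sum>m<k. l m) + B * l k"
    by (intro tendsto_intros l)
  moreover have "(\<Sum>m<k. (\<Sum>i\<le>n. ?w m i) - iter_log (Suc m) (real n)) +
      B * ((\<Sum>i\<le>n. ?w k i) - iter_log (Suc k) (real n)) =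
      (\<Sum>i\<le>n. Lambda_real k B (real i)) - Lambda_int k B (real n)" for n
  proof -
    have "(\<Sum>m<k. \<Sum>i\<le>n. ?w m i) = (\<Sum>i\<le>n. \<Sum>m<k. ?w m i)" by (rule sum.swap)
    then show ?thesis
      unfolding Lambda_real_def Lambda_int_def sum_subtractf sum.distrib sum_distrib_left right_diff_distrib
      by linarith
  qed
  ultimately show "convergent (\<lambda>n. (\<Sum>i\<le>n. Lambda_real k B (real i)) - Lambda_int k B (real n))"
    by (auto simp: convergent_def)
qed

section \<open>From increments to inverse increments\<close>

text \<open>From \<open>N\<close> on the increments of \<open>a - c * b\<close> are at most
  \<open>e / 2\<close> times those of \<open>b\<close>. Summing leaves a constant \<open>C\<close>,
  which is negligible because \<open>b\<close> diverges.\<close>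

lemma Stolz_Cesaro:
  fixes a b :: "nat \<Rightarrow> real"
  assumes lim: "(\<lambda>n. (a (Suc n) - a n) / (b (Suc n) - b n)) \<longlonglongrightarrow> c"
    and incr: "\<forall>\<^sub>F n in sequentially. b n < b (Suc n)"
    and top: "filterlim b at_top sequentially"
  shows "(\<lambda>n. a n / b n) \<longlonglongrightarrow> c"
proof (rule tendstoI)
  fix e :: real assume "0 < e"
  then have "\<forall>\<^sub>F n in sequentially. dist ((a (Suc n) - a n) / (b (Suc n) - b n)) c < e / 2"
    by (intro tendstoD[OF lim]) simp
  from eventually_conj[OF this incr] obtain N where
    N: "\<And>n. N \<le> n \<Longrightarrow> dist ((a (Suc n) - a n) / (b (Suc n) - b n)) c < e / 2 \<and> b n < b (Suc n)"
    unfolding eventually_sequentially by blast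
  have Stolz_step: "\<bar>(a (Suc n) - a n) - c * (b (Suc n) - b n)\<bar> \<le> e / 2 * (b (Suc n) - b n)" if "N \<le> n" for n
  proof -
    define x y where "x = a (Suc n) - a n" and "y = b (Suc n) - b n"
    have "0 < y" "\<bar>x / y - c\<bar> < e / 2" using N[OF that] by (auto simp: x_def y_def dist_real_def)
    then have "\<bar>x / y - c\<bar> * y \<le> e / 2 * y" by (intro mult_right_mono) auto
    also have "\<bar>x / y - c\<bar> * y = \<bar>(x / y - c) * y\<bar>" using \<open>0 < y\<close> by (simp add: abs_mult)
    also have "(x / y - c) * y = x - c * y" using \<open>0 < y\<close> by (simp add: left_diff_distrib)
    finally show ?thesis by (simp add: x_def y_def)
  qed
  define C where "C = \<bar>a N - c * b N\<bar> - e / 2 * b N"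
  have bound: "\<bar>a n - c * b n\<bar> \<le> C + e / 2 * b n" if "N \<le> n" for n
    using that
  proof (induction rule: dec_induct)
    case (step m)
    from step.hyps have "N \<le> m" by simp
    have "a (Suc m) - c * b (Suc m) = (a m - c * b m) + ((a (Suc m) - a m) - c * (b (Suc m) - b m))"
      by (simp add: algebra_simps)
    then have "\<bar>a (Suc m) - c * b (Suc m)\<bar> \<le>
        \<bar>a m - c * b m\<bar> + \<bar>(a (Suc m) - a m) - c * (b (Suc m) - b m)\<bar>" by linarith
    also have "\<dots> \<le> (C + e / 2 * b m) + e / 2 * (b (Suc m) - b m)"
      by (intro add_mono step.IH \<open>N \<le> m\<close> Stolz_step)
    finally show ?case by (simp add: right_diff_distrib)
  qed (simp add: C_def)
  \<comment> \<open>The bound with 4 gives \<open>C \<le> e / 4 * b n\<close>, so the total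
    \<open>3/4 * e * b n\<close> stays strictly below \<open>e * b n\<close>; the 1 ensures that
    \<open>b n\<close> is positive.\<close>
  have "\<forall>\<^sub>F n in sequentially. max 1 (4 * C / e) \<le> b n"
    using top[unfolded filterlim_at_top] by blast
  then show "\<forall>\<^sub>F n in sequentially. dist (a n / b n) c < e"
    using eventually_ge_at_top[of N]
  proof eventually_elim
    case (elim n)
    then have pos: "0 < b n" by simp
    have "4 * C / e \<le> b n" using elim by simp
    then have "C \<le> e / 4 * b n" using \<open>0 < e\<close> by (simp add: field_simps)
    moreover have "0 < e / 4 * b n" using \<open>0 < e\<close> pos by simp
    ultimately have "\<bar>a n - c * b n\<bar> < e * b n" using bound[OF elim(2)] by argo
    then have "\<bar>a n - c * b n\<bar> / b n < e" using pos by (simp add: divide_less_eq)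
    moreover have "\<bar>a n - c * b n\<bar> / b n = \<bar>(a n - c * b n) / b n\<bar>" using pos by simp
    moreover have "(a n - c * b n) / b n = a n / b n - c" using pos by (simp add: diff_divide_distrib)
    ultimately show ?case by (simp add: dist_real_def)
  qed
qed

text \<open>The mean value theorem is applied twice: the increment of \<open>F\<close> equals
  \<open>\<phi>\<close> at a point \<open>\<xi> n\<close> within distance 1 of \<open>n\<close>, and
  since \<open>h'\<close> tends to 0, \<open>h (\<xi> n) - h n\<close> vanishes in the
  limit.\<close>

lemma increment_asymp:
  fixes F \<phi> h h' :: "real \<Rightarrow> real"
  assumes F: "\<forall>\<^sub>F x in at_top. (F has_real_derivative \<phi> x) (at x)"
    and \<phi>: "((\<lambda>x. \<phi> x / exp (h x)) \<longlongrightarrow> 1) at_top"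
    and h: "\<forall>\<^sub>F x in at_top. (h has_real_derivative h' x) (at x)"
    and h': "(h' \<longlongrightarrow> 0) at_top"
  shows "(\<lambda>n. (F (real (Suc n)) - F (real n)) / exp (h (real n))) \<longlonglongrightarrow> 1"
proof -
  obtain X where X: "\<And>x. X \<le> x \<Longrightarrow> (F has_real_derivative \<phi> x) (at x) \<and> (h has_real_derivative h' x) (at x)"
    using eventually_conj[OF F h] unfolding eventually_at_top_linorder by blast
  have "\<exists>\<xi>. real n < \<xi> \<and> \<xi> < real (Suc n) \<and> F (real (Suc n)) - F (real n) = \<phi> \<xi>" if "X \<le> real n" for n
    using MVT2[of "real n" "real (Suc n)" F \<phi>] X that by fastforce
  then obtain \<xi> where \<xi>: "\<And>n. X \<le> real n \<Longrightarrow>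
      real n < \<xi> n \<and> \<xi> n < real (Suc n) \<and> F (real (Suc n)) - F (real n) = \<phi> (\<xi> n)" by metis
  have "\<exists>\<eta>. real n < \<eta> \<and> \<eta> < \<xi> n \<and> h (\<xi> n) - h (real n) = (\<xi> n - real n) * h' \<eta>" if "X \<le> real n" for n
    using MVT2[of "real n" "\<xi> n" h h'] X \<xi>[OF that] that by auto
  then obtain \<eta> where \<eta>: "\<And>n. X \<le> real n \<Longrightarrow>
      real n < \<eta> n \<and> \<eta> n < \<xi> n \<and> h (\<xi> n) - h (real n) = (\<xi> n - real n) * h' (\<eta> n)" by metis
  have ev: "\<forall>\<^sub>F n in sequentially. X \<le> real n"
    using filterlim_real_sequentially by (simp add: filterlim_at_top)
  have \<xi>_top: "filterlim \<xi> at_top sequentially"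
    by (rule filterlim_at_top_mono[OF filterlim_real_sequentially], rule eventually_mono[OF ev])
      (use \<xi> in \<open>auto simp: less_imp_le\<close>)
  have \<eta>_top: "filterlim \<eta> at_top sequentially"
    by (rule filterlim_at_top_mono[OF filterlim_real_sequentially], rule eventually_mono[OF ev])
      (use \<eta> in \<open>auto simp: less_imp_le\<close>)
  have "(\<lambda>n. h (\<xi> n) - h (real n)) \<longlonglongrightarrow> 0"
  proof (rule Lim_null_comparison)
    show "(\<lambda>n. \<bar>h' (\<eta> n)\<bar>) \<longlonglongrightarrow> 0"
      using filterlim_compose[OF h' \<eta>_top] by (rule tendsto_rabs_zero)
    show "\<forall>\<^sub>F n in sequentially. norm (h (\<xi> n) - h (real n)) \<le> \<bar>h' (\<eta> n)\<bar>"
      using ev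
    proof eventually_elim
      case (elim n)
      have "\<bar>\<xi> n - real n\<bar> * \<bar>h' (\<eta> n)\<bar> \<le> 1 * \<bar>h' (\<eta> n)\<bar>"
        using \<xi>[OF elim] by (intro mult_right_mono) auto
      then show ?case using \<eta>[OF elim] by (simp add: abs_mult)
    qed
  qed
  then have "(\<lambda>n. \<phi> (\<xi> n) / exp (h (\<xi> n)) * exp (h (\<xi> n) - h (real n))) \<longlonglongrightarrow> 1 * exp 0"
    by (intro tendsto_intros filterlim_compose[OF \<phi> \<xi>_top])
  then have "(\<lambda>n. \<phi> (\<xi> n) / exp (h (\<xi> n)) * exp (h (\<xi> n) - h (real n))) \<longlonglongrightarrow> 1" by simp
  then show ?thesis
  proof (rule Lim_transform_eventually)
    show "\<forall>\<^sub>F n in sequentially. \<phi> (\<xi> n) / exp (h (\<xi> n)) * exp (h (\<xi> n) - h (real n)) =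
        (F (real (Suc n)) - F (real n)) / exp (h (real n))"
      using ev by eventually_elim (use \<xi> in \<open>simp add: exp_diff\<close>)
  qed
qed

text \<open>The difference of inverses is the increment of \<open>f\<close> over
  \<open>f n * f (Suc n)\<close>, so only the growth of \<open>f\<close> is left to find. It is read
  off from \<open>F\<close>, a primitive of \<open>exp h\<close> up to equivalence: a divergent
  \<open>F\<close> contributes \<open>1 / F^2\<close>, a convergent one only a constant.\<close>

lemma inverse_increment_asymp:
  fixes f :: "nat \<Rightarrow> real" and F \<phi> h h' :: "real \<Rightarrow> real"
  assumes c: "0 < c" "(\<lambda>n. (f (Suc n) - f n) / exp (h (real n))) \<longlonglongrightarrow> c"
    and F: "\<forall>\<^sub>F x in at_top. (F has_real_derivative \<phi> x) (at x)"
    and \<phi>: "((\<lambda>x. \<phi> x / exp (h x)) \<longlongrightarrow> 1) at_top"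
    and h: "\<forall>\<^sub>F x in at_top. (h has_real_derivative h' x) (at x)"
    and h': "(h' \<longlongrightarrow> 0) at_top"
  shows inverse_increment_asymp_at_top:
    "filterlim F at_top at_top \<Longrightarrow> ((\<lambda>x. exp (h x) / F x) \<longlongrightarrow> 0) at_top \<Longrightarrow>
      (\<lambda>n. (1 / f n - 1 / f (Suc n)) / (exp (h (real n)) / (F (real n))\<^sup>2)) \<longlonglongrightarrow> 1 / c"
    and inverse_increment_asymp_convergent:
    "(F \<longlongrightarrow> l) at_top \<Longrightarrow> (\<And>n. 2 \<le> n \<Longrightarrow> 1 \<le> f n) \<Longrightarrow>
      \<exists>c>0. (\<lambda>n. (1 / f n - 1 / f (Suc n)) / exp (h (real n))) \<longlonglongrightarrow> c"
proof -
  note incr = increment_asymp[OF F \<phi> h h']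
  have "(\<lambda>n. ((f (Suc n) - f n) / exp (h (real n))) / ((F (real (Suc n)) - F (real n)) / exp (h (real n)))) \<longlonglongrightarrow> c / 1"
    by (intro tendsto_divide c incr) simp
  then have ratio: "(\<lambda>n. (f (Suc n) - f n) / (F (real (Suc n)) - F (real n))) \<longlonglongrightarrow> c" by simp
  have F_incr: "\<forall>\<^sub>F n in sequentially. F (real n) < F (real (Suc n))"
    using order_tendstoD(1)[OF incr zero_less_one]
    by eventually_elim (simp add: zero_less_divide_iff)
  have f_incr: "\<forall>\<^sub>F n in sequentially. f n < f (Suc n)"
    using order_tendstoD(1)[OF c(2,1)]
    by eventually_elim (simp add: zero_less_divide_iff)
  {
    assume top: "filterlim F at_top at_top" and small: "((\<lambda>x. exp (h x) / F x) \<longlongrightarrow> 0) at_top"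
    have F_top: "filterlim (\<lambda>n. F (real n)) at_top sequentially"
      by (rule filterlim_compose[OF top filterlim_real_sequentially])
    have small': "(\<lambda>n. exp (h (real n)) / F (real n)) \<longlonglongrightarrow> 0"
      by (rule filterlim_compose[OF small filterlim_real_sequentially])
    have fF: "(\<lambda>n. f n / F (real n)) \<longlonglongrightarrow> c"
      by (rule Stolz_Cesaro[OF ratio F_incr F_top])
    \<comment> \<open>\<open>f (Suc n)\<close> is \<open>f n\<close> plus an increment negligible
      against \<open>F\<close>, so both factors of the denominator behave like
      \<open>c * F n\<close>.\<close>
    have "(\<lambda>n. f n / F (real n) + (f (Suc n) - f n) / exp (h (real n)) * (exp (h (real n)) / F (real n))) \<longlonglongrightarrow> c + c * 0"
      by (intro tendsto_intros fF c small')
    then have fSF: "(\<lambda>n. f (Suc n) / F (real n)) \<longlonglongrightarrow> c"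
      by (simp add: add_divide_distrib[symmetric])
    have "(\<lambda>n. ((f (Suc n) - f n) / exp (h (real n))) / ((f n / F (real n)) * (f (Suc n) / F (real n)))) \<longlonglongrightarrow> c / (c * c)"
      using c(1) by (intro tendsto_intros c(2) fF fSF) auto
    moreover have "\<forall>\<^sub>F n in sequentially.
        ((f (Suc n) - f n) / exp (h (real n))) / ((f n / F (real n)) * (f (Suc n) / F (real n))) =
        (1 / f n - 1 / f (Suc n)) / (exp (h (real n)) / (F (real n))\<^sup>2)"
      using order_tendstoD(1)[OF fF c(1)] order_tendstoD(1)[OF fSF c(1)]
    proof eventually_elim
      case (elim n)
      then have "f n \<noteq> 0" "f (Suc n) \<noteq> 0" "F (real n) \<noteq> 0" by auto
      then show ?case by (simp add: field_simps power2_eq_square)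
    qed
    ultimately have "(\<lambda>n. (1 / f n - 1 / f (Suc n)) / (exp (h (real n)) / (F (real n))\<^sup>2)) \<longlonglongrightarrow> c / (c * c)"
      by (rule Lim_transform_eventually)
    then show "(\<lambda>n. (1 / f n - 1 / f (Suc n)) / (exp (h (real n)) / (F (real n))\<^sup>2)) \<longlonglongrightarrow> 1 / c"
      using c(1) by simp
  }
  {
    assume lim: "(F \<longlongrightarrow> l) at_top" and ge: "\<And>n. 2 \<le> n \<Longrightarrow> 1 \<le> f n"
    have "(\<lambda>n. F (real n)) \<longlonglongrightarrow> l" by (rule filterlim_compose[OF lim filterlim_real_sequentially])
    then have "summable (\<lambda>n. F (real (Suc n)) - F (real n))" by (rule telescope_summable)
    then have "summable (\<lambda>n. (c + 1) * (F (real (Suc n)) - F (real n)))" by (rule summable_mult)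
    \<comment> \<open>The increments of \<open>f\<close> are dominated by those of \<open>F\<close>,
      which form a convergent telescoping series.\<close>
    moreover have "\<forall>\<^sub>F n in sequentially. norm (f (Suc n) - f n) \<le> (c + 1) * (F (real (Suc n)) - F (real n))"
      using order_tendstoD(2)[OF ratio less_add_one] F_incr f_incr
    proof eventually_elim
      case (elim n)
      then show ?case by (simp add: divide_less_eq less_imp_le)
    qed
    ultimately have "summable (\<lambda>n. f (Suc n) - f n)" by (rule summable_comparison_test_ev[rotated])
    then have "(\<lambda>n. (\<Sum>k<n. f (Suc k) - f k) + f 0) \<longlonglongrightarrow> (\<Sum>k. f (Suc k) - f k) + f 0"
      by (intro tendsto_intros summable_LIMSEQ)
    then obtain A where A: "f \<longlonglongrightarrow> A" by (auto simp: sum_lessThan_telescope)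
    then have "1 \<le> A" using ge by (intro LIMSEQ_le_const[OF A]) blast
    have "(\<lambda>n. ((f (Suc n) - f n) / exp (h (real n))) / (f n * f (Suc n))) \<longlonglongrightarrow> c / (A * A)"
      using \<open>1 \<le> A\<close> by (intro tendsto_intros c(2) A LIMSEQ_Suc[OF A]) auto
    moreover have "\<forall>\<^sub>F n in sequentially. ((f (Suc n) - f n) / exp (h (real n))) / (f n * f (Suc n)) =
        (1 / f n - 1 / f (Suc n)) / exp (h (real n))"
      using eventually_ge_at_top[of 2]
    proof eventually_elim
      case (elim n)
      then have "f n \<noteq> 0" "f (Suc n) \<noteq> 0" using ge[of n] ge[of "Suc n"] by auto
      then show ?case by (simp add: field_simps)
    qed
    ultimately have "(\<lambda>n. (1 / f n - 1 / f (Suc n)) / exp (h (real n))) \<longlonglongrightarrow> c / (A * A)"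
      by (rule Lim_transform_eventually)
    moreover have "0 < c / (A * A)" using c(1) \<open>1 \<le> A\<close> by simp
    ultimately show "\<exists>c>0. (\<lambda>n. (1 / f n - 1 / f (Suc n)) / exp (h (real n))) \<longlonglongrightarrow> c" by blast
  }
qed

section \<open>Asymptotics of the law of the maximum\<close>

lemma scale_fn_ge_1:
  assumes "\<And>k. 2 \<le> k \<Longrightarrow> 0 < \<theta> k" and "2 \<le> n"
  shows "1 \<le> scale_fn \<theta> n"
  using assms(2)
proof (induction rule: dec_induct)
  case (step m)
  have "0 < scale_incr \<theta> m" by (rule scale_incr_pos[OF assms(1)]) (use step in auto)
  with step show ?case by (simp add: scale_fn_Suc)
qed simp

lemma asymp_equiv_of_tendsto_div:
  fixes P T D :: "nat \<Rightarrow> real"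
  assumes "(\<lambda>n. P n / T n) \<longlonglongrightarrow> c" "0 < c" "0 < a" "\<forall>\<^sub>F n in sequentially. T n = a / D n"
  shows "\<exists>c>0. P \<sim>[sequentially] (\<lambda>n. c / D n)"
proof (intro exI conjI)
  have "P \<sim>[sequentially] (\<lambda>n. c * T n)" using assms(1,2) by (intro asymp_equivI'_const) auto
  also have "\<forall>\<^sub>F n in sequentially. c * T n = (c * a) / D n"
    using assms(4) by eventually_elim simp
  then have "(\<lambda>n. c * T n) \<sim>[sequentially] (\<lambda>n. (c * a) / D n)" by (rule asymp_equiv_refl_ev)
  finally show "P \<sim>[sequentially] (\<lambda>n. (c * a) / D n)" .
  show "0 < c * a" using assms by simp
qed

lemma eventually_real_sequentially:
  assumes "\<forall>\<^sub>F x in at_top. Q (x::real)"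
  shows "\<forall>\<^sub>F n in sequentially. Q (real n)"
  using assms filterlim_real_sequentially by (rule eventually_compose_filterlim)

section \<open>Primitives of \<open>exp (- Lambda_int)\<close> and
  \<open>exp (Lambda_int)\<close>\<close>

lemma exp_minus_Lambda_int:
  "\<forall>\<^sub>F x in at_top. exp (- Lambda_int k B x) = 1 / ((\<Prod>j<k. iter_log j x) * iter_log k x powr B)"
  using exp_Lambda_int[of k B] by eventually_elim (simp add: exp_minus inverse_eq_divide)

lemma DERIV_minus_Lambda_int:
  "\<forall>\<^sub>F x in at_top. ((\<lambda>x. - Lambda_int k B x) has_real_derivative - Lambda_real k B x) (at x)"
  using DERIV_Lambda_int[of k B] by eventually_elim (rule DERIV_minus)

lemma minus_Lambda_real_tendsto_0: "((\<lambda>x. - Lambda_real k B x) \<longlongrightarrow> 0) at_top"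
  using tendsto_minus[OF Lambda_real_tendsto_0] by simp

text \<open>In the critical case the exponential is the derivative of
  \<open>iter_log (Suc k)\<close>, hence the additional logarithm for \<open>B = 1\<close>.\<close>

lemma exp_minus_Lambda_int_1: "\<forall>\<^sub>F x in at_top. exp (- Lambda_int k 1 x) = iter_log_weight k x"
  using exp_minus_Lambda_int[of k 1] eventually_iter_log_ge[of k 1]
proof eventually_elim
  case (elim x)
  then have "0 < iter_log k x" by fastforce
  with elim show ?case
    by (simp add: iter_log_weight_def lessThan_Suc_atMost[symmetric])
qed

lemma filterlim_iter_log_powr:
  assumes "0 < a"
  shows "filterlim (\<lambda>x. iter_log k x powr a) at_top at_top"
proof -
  have "filterlim (\<lambda>x. exp (a * iter_log (Suc k) x)) at_top at_top"
    using assms by (intro filterlim_compose[OF exp_at_top]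
        filterlim_tendsto_pos_mult_at_top[OF tendsto_const] filterlim_iter_log)
  moreover have "\<forall>\<^sub>F x in at_top. exp (a * iter_log (Suc k) x) = iter_log k x powr a"
    using eventually_iter_log_ge[of k 1]
  proof eventually_elim
    case (elim x)
    then have "iter_log k x \<noteq> 0" by fastforce
    then show ?case by (simp add: powr_def iter_log_Suc)
  qed
  ultimately show ?thesis by (rule filterlim_cong[OF refl refl, THEN iffD1, rotated])
qed

text \<open>This primitive tends to 0 for \<open>1 < B\<close> and to infinity for
  \<open>B < 1\<close>, which decides whether the scale function is bounded.\<close>

lemma DERIV_iter_log_powr:
  assumes "B \<noteq> 1"
  shows "\<forall>\<^sub>F x in at_top. ((\<lambda>x. iter_log k x powr (1 - B) / (1 - B)) has_real_derivative
    exp (- Lambda_int k B x)) (at x)"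
  using exp_minus_Lambda_int[of k B] eventually_iter_log_ge[of k 1]
proof eventually_elim
  case (elim x)
  have pos: "0 < iter_log j x" if "j \<le> k" for j
    using elim(2) that by (meson less_le_trans zero_less_one)
  have "(iter_log k has_real_derivative 1 / (\<Prod>j<k. iter_log j x)) (at x)"
    by (rule DERIV_iter_log) (simp add: pos)
  from DERIV_chain2[OF has_real_derivative_powr[OF pos[OF order_refl]] this, of "1 - B"]
  have "((\<lambda>x. iter_log k x powr (1 - B) / (1 - B)) has_real_derivative
      ((1 - B) * iter_log k x powr (1 - B - 1) * (1 / (\<Prod>j<k. iter_log j x))) / (1 - B)) (at x)"
    by (rule DERIV_cdivide)
  moreover have "((1 - B) * iter_log k x powr (1 - B - 1) * (1 / (\<Prod>j<k. iter_log j x))) / (1 - B) =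
      exp (- Lambda_int k B x)"
    using assms elim by (simp add: powr_minus_divide)
  ultimately show ?case by simp
qed

text \<open>Only the weight \<open>1 / x\<close> survives multiplication by \<open>x\<close>; all
  others carry a further factor \<open>1 / log x\<close>. For \<open>k > 0\<close> that weight has
  coefficient 1 rather than \<open>B\<close>.\<close>

lemma mult_Lambda_real_tendsto_1:
  assumes "0 < k"
  shows "((\<lambda>x. x * Lambda_real k B x) \<longlongrightarrow> 1) at_top"
proof -
  have w: "((\<lambda>x. x * iter_log_weight m x) \<longlongrightarrow> (if m = 0 then 1 else 0)) at_top" for m
  proof (cases "m = 0")
    case True
    have "\<forall>\<^sub>F x in at_top. 1 = x * iter_log_weight m x"
      using eventually_gt_at_top[of 0] by eventually_elim (simp add: True iter_log_weight_def)
    with tendsto_const have "((\<lambda>x. x * iter_log_weight m x) \<longlongrightarrow> 1) at_top"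
      by (rule Lim_transform_eventually)
    then show ?thesis using True by simp
  next
    case False
    have "((\<lambda>x. 1 / iter_log 1 x) \<longlongrightarrow> 0) at_top"
      by (rule filterlim_compose[OF one_div_tendsto_0_at_top filterlim_iter_log])
    moreover have "\<forall>\<^sub>F x in at_top. norm (x * iter_log_weight m x) \<le> 1 / iter_log 1 x"
      using eventually_iter_log_ge[of m 1] eventually_gt_at_top[of 0]
    proof eventually_elim
      case (elim x)
      have "{..m} = insert 0 (insert 1 {2..m})" using False by auto
      then have "(\<Prod>j\<le>m. iter_log j x) = x * (iter_log 1 x * (\<Prod>j=2..m. iter_log j x))" by simp
      then have eq: "x * iter_log_weight m x = 1 / (iter_log 1 x * (\<Prod>j=2..m. iter_log j x))"
        using elim(2) by (simp add: iter_log_weight_def)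
      have "1 \<le> iter_log 1 x" using elim(1) False by (simp add: Suc_leI)
      moreover have "1 \<le> (\<Prod>j=2..m. iter_log j x)" using elim(1) by (intro prod_ge_1) auto
      ultimately have "1 / (iter_log 1 x * (\<Prod>j=2..m. iter_log j x)) \<le> 1 / iter_log 1 x"
          "0 \<le> 1 / (iter_log 1 x * (\<Prod>j=2..m. iter_log j x))"
        by (auto intro!: divide_left_mono mult_pos_pos)
      then show ?case unfolding eq by simp
    qed
    ultimately have "((\<lambda>x. x * iter_log_weight m x) \<longlongrightarrow> 0) at_top"
      by (rule Lim_null_comparison[rotated])
    then show ?thesis using False by simp
  qed
  have "((\<lambda>x. (\<Sum>m<k. x * iter_log_weight m x) + B * (x * iter_log_weight k x)) \<longlongrightarrow>
      (\<Sum>m<k. if m = 0 then 1 else 0) + B * (if k = 0 then 1 else 0)) at_top"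
    by (intro tendsto_intros w)
  moreover have "(\<lambda>x. (\<Sum>m<k. x * iter_log_weight m x) + B * (x * iter_log_weight k x)) =
      (\<lambda>x. x * Lambda_real k B x)"
    by (simp add: fun_eq_iff Lambda_real_def sum_distrib_left distrib_left mult.left_commute)
  moreover have "(\<Sum>m<k. if m = 0 then 1 else 0) + B * (if k = 0 then 1 else 0) = 1"
    using assms by simp
  ultimately show ?thesis by simp
qed

text \<open>For \<open>k > 0\<close> this function is, up to asymptotic equivalence, a primitive of \<open>exp (Lambda_int k B x)\<close>.\<close>

lemma DERIV_mult_exp_Lambda_int:
  "\<forall>\<^sub>F x in at_top. ((\<lambda>x. x * exp (Lambda_int k B x) / 2) has_real_derivative
    exp (Lambda_int k B x) * (1 + x * Lambda_real k B x) / 2) (at x)"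
  using DERIV_Lambda_int[of k B]
  by eventually_elim (auto intro!: derivative_eq_intros simp: algebra_simps)

text \<open>\<open>Lambda\<close> is eventually positive whatever the sign of \<open>B\<close>, so
  \<open>Lambda_int\<close> is eventually nondecreasing and its exponential stays above a positive
  constant.\<close>

lemma filterlim_mult_exp_Lambda_int:
  assumes "0 < k"
  shows "filterlim (\<lambda>x. x * exp (Lambda_int k B x) / 2) at_top at_top"
proof -
  have "\<forall>\<^sub>F x in at_top. 0 < x * Lambda_real k B x"
    by (rule order_tendstoD(1)[OF mult_Lambda_real_tendsto_1[OF assms]]) simp
  from eventually_conj[OF this eventually_conj[OF eventually_gt_at_top[of 0] DERIV_Lambda_int[of k B]]]
  obtain X where X: "\<And>x. X \<le> x \<Longrightarrow> 0 < x * Lambda_real k B x \<and> 0 < x \<and>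
      (Lambda_int k B has_real_derivative Lambda_real k B x) (at x)"
    unfolding eventually_at_top_linorder by blast
  have mono: "Lambda_int k B X \<le> Lambda_int k B x" if "X \<le> x" for x
  proof (rule DERIV_nonneg_imp_nondecreasing[OF that])
    fix y assume "X \<le> y" "y \<le> x"
    then show "\<exists>z. (Lambda_int k B has_real_derivative z) (at y) \<and> 0 \<le> z"
      using X[of y] by (auto simp: zero_less_mult_iff intro!: exI[of _ "Lambda_real k B y"])
  qed
  have "filterlim (\<lambda>x. exp (Lambda_int k B X) / 2 * x) at_top at_top"
    by (rule filterlim_tendsto_pos_mult_at_top[OF tendsto_const _ filterlim_ident]) simp
  then show ?thesis
  proof (rule filterlim_at_top_mono)
    show "\<forall>\<^sub>F x in at_top. exp (Lambda_int k B X) / 2 * x \<le> x * exp (Lambda_int k B x) / 2"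
      using eventually_ge_at_top[of X]
    proof eventually_elim
      case (elim x)
      then have "exp (Lambda_int k B X) * x \<le> exp (Lambda_int k B x) * x"
        using mono[OF elim] X[OF elim] by (intro mult_right_mono) auto
      then show ?case by (simp add: mult.commute)
    qed
  qed
qed

section \<open>The two signs of the perturbation\<close>

context two_one_walk
begin

lemma ratio_pos: "2 \<le> n \<Longrightarrow> 0 < p n / q n"
  using p_pos q_pos by simp

text \<open>Used with \<open>\<sigma> = 1\<close> and \<open>\<sigma> = -1\<close>. The sum of the
  \<open>s i\<close> may be replaced by \<open>\<sigma> * Lambda_int\<close> because the two differ
  by a convergent sequence, which changes only the constant.\<close>

lemma scale_incr_pert_asymp:
  assumes q: "\<And>i. 2 \<le> i \<Longrightarrow> q i = 2 / 3 + \<sigma> * pert (Suc k) B i"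
  shows "\<exists>c>0. (\<lambda>n. scale_incr (\<lambda>i. p i / q i) n / exp (- \<sigma> * Lambda_int k B (real n))) \<longlonglongrightarrow> c"
proof -
  define s where "s n = \<sigma> * Lambda_real k B (real n)" for n
  have "\<exists>c>0. (\<lambda>n. scale_incr (\<lambda>i. p i / q i) n * exp (\<Sum>i\<le>n. s i)) \<longlonglongrightarrow> c"
  proof (rule scale_incr_asymp)
    show "\<forall>\<^sub>F n in sequentially. p n / q n = (1 - s n) / (2 + s n)"
      \<comment> \<open>Beyond \<open>start_index\<close> the maximum in \<open>pert\<close> is
        \<open>n\<close> itself, so the freezing is no longer visible.\<close>
      using eventually_ge_at_top[of "max 2 (start_index (Suc k) B)"]
    proof eventually_elim
      case (elim n)
      then have "pert (Suc k) B n = Lambda_real k B (real n) / 3"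
        by (simp add: pert_def max_absorb1 Lambda_eq_Lambda_real)
      moreover have "2 \<le> n" using elim by simp
      ultimately have qn: "q n = (2 + s n) / 3" using q[of n] by (simp add: s_def)
      have pn: "p n = (1 - s n) / 3" using q_plus_p[OF \<open>2 \<le> n\<close>] unfolding qn by (simp add: field_simps)
      have "a / 3 / (b / 3) = a / b" for a b :: real by simp
      then show ?case unfolding pn qn .
    qed
    show "summable (\<lambda>n. (s n)\<^sup>2)"
      unfolding s_def power_mult_distrib by (intro summable_mult summable_Lambda_real_sq)
    have "(\<lambda>n. \<bar>s (Suc n) - s n\<bar>) =
        (\<lambda>n. \<bar>\<sigma>\<bar> * \<bar>Lambda_real k B (real (Suc n)) - Lambda_real k B (real n)\<bar>)"
      unfolding s_def abs_mult[symmetric] right_diff_distrib ..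
    then show "summable (\<lambda>n. \<bar>s (Suc n) - s n\<bar>)"
      by (simp only: summable_mult[OF Lambda_real_sum(1)])
  qed (use ratio_pos in auto)
  then obtain c where c: "0 < c" "(\<lambda>n. scale_incr (\<lambda>i. p i / q i) n * exp (\<Sum>i\<le>n. s i)) \<longlonglongrightarrow> c"
    by blast
  obtain l where l: "(\<lambda>n. (\<Sum>i\<le>n. Lambda_real k B (real i)) - Lambda_int k B (real n)) \<longlonglongrightarrow> l"
    using Lambda_real_sum(2) unfolding convergent_def by blast
  have "(\<lambda>n. (scale_incr (\<lambda>i. p i / q i) n * exp (\<Sum>i\<le>n. s i)) /
      exp (\<sigma> * ((\<Sum>i\<le>n. Lambda_real k B (real i)) - Lambda_int k B (real n)))) \<longlonglongrightarrow> c / exp (\<sigma> * l)"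
    by (intro tendsto_intros c l) simp
  moreover have "(scale_incr (\<lambda>i. p i / q i) n * exp (\<Sum>i\<le>n. s i)) /
      exp (\<sigma> * ((\<Sum>i\<le>n. Lambda_real k B (real i)) - Lambda_int k B (real n))) =
      scale_incr (\<lambda>i. p i / q i) n / exp (- \<sigma> * Lambda_int k B (real n))" for n
    unfolding s_def sum_distrib_left[symmetric] right_diff_distrib exp_diff by (simp add: exp_minus field_simps)
  ultimately have "(\<lambda>n. scale_incr (\<lambda>i. p i / q i) n / exp (- \<sigma> * Lambda_int k B (real n))) \<longlonglongrightarrow> c / exp (\<sigma> * l)"
    by simp
  moreover have "0 < c / exp (\<sigma> * l)" using c by simp
  ultimately show ?thesis by blast
qed

lemma max_prob_asymp:
  assumes Y0: "AE \<omega> in N. Y 0 \<omega> = 2"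
    and incr: "\<exists>c>0. (\<lambda>n. scale_incr (\<lambda>i. p i / q i) n / exp (h (real n))) \<longlonglongrightarrow> c"
    and F: "\<forall>\<^sub>F x in at_top. (F has_real_derivative \<phi> x) (at x)"
    and \<phi>: "((\<lambda>x. \<phi> x / exp (h x)) \<longlongrightarrow> 1) at_top"
    and h: "\<forall>\<^sub>F x in at_top. (h has_real_derivative h' x) (at x)"
    and h': "(h' \<longlongrightarrow> 0) at_top"
  shows max_prob_asymp_at_top:
    "filterlim F at_top at_top \<Longrightarrow> ((\<lambda>x. exp (h x) / F x) \<longlongrightarrow> 0) at_top \<Longrightarrow>
      0 < a \<Longrightarrow> \<forall>\<^sub>F n in sequentially. exp (h (real n)) / (F (real n))\<^sup>2 = a / D n \<Longrightarrow>
      \<exists>c>0. max_prob N Y \<sim>[sequentially] (\<lambda>n. c / D n)"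
    and max_prob_asymp_convergent:
    "(F \<longlongrightarrow> l) at_top \<Longrightarrow> \<forall>\<^sub>F n in sequentially. exp (h (real n)) = 1 / D n \<Longrightarrow>
      \<exists>c>0. max_prob N Y \<sim>[sequentially] (\<lambda>n. c / D n)"
proof -
  define f where "f = scale_fn (\<lambda>i. p i / q i)"
  obtain c where c: "0 < c" "(\<lambda>n. (f (Suc n) - f n) / exp (h (real n))) \<longlonglongrightarrow> c"
    using incr by (auto simp: f_def scale_fn_Suc)
  have ge: "1 \<le> f n" if "2 \<le> n" for n
    unfolding f_def by (rule scale_fn_ge_1[OF ratio_pos that])
  have eq: "\<forall>\<^sub>F n in sequentially. (1 / f n - 1 / f (Suc n)) / T n = max_prob N Y n / T n" for T :: "nat \<Rightarrow> real"
    using eventually_gt_at_top[of 2] by eventually_elim (simp add: max_prob_eq[OF Y0] f_def)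
  {
    assume top: "filterlim F at_top at_top" "((\<lambda>x. exp (h x) / F x) \<longlongrightarrow> 0) at_top"
      and a: "0 < a" "\<forall>\<^sub>F n in sequentially. exp (h (real n)) / (F (real n))\<^sup>2 = a / D n"
    have "(\<lambda>n. (1 / f n - 1 / f (Suc n)) / (exp (h (real n)) / (F (real n))\<^sup>2)) \<longlonglongrightarrow> 1 / c"
      by (rule inverse_increment_asymp_at_top[OF c F \<phi> h h' top])
    then have "(\<lambda>n. max_prob N Y n / (exp (h (real n)) / (F (real n))\<^sup>2)) \<longlonglongrightarrow> 1 / c"
      using eq by (rule Lim_transform_eventually)
    then show "\<exists>c>0. max_prob N Y \<sim>[sequentially] (\<lambda>n. c / D n)"
      by (rule asymp_equiv_of_tendsto_div[OF _ _ a]) (use c in simp)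
  }
  {
    assume lim: "(F \<longlongrightarrow> l) at_top" and D: "\<forall>\<^sub>F n in sequentially. exp (h (real n)) = 1 / D n"
    obtain c' where c': "0 < c'" "(\<lambda>n. (1 / f n - 1 / f (Suc n)) / exp (h (real n))) \<longlonglongrightarrow> c'"
      using inverse_increment_asymp_convergent[OF c F \<phi> h h' lim ge] by blast
    from c'(2) eq have "(\<lambda>n. max_prob N Y n / exp (h (real n))) \<longlonglongrightarrow> c'"
      by (rule Lim_transform_eventually)
    then show "\<exists>c>0. max_prob N Y \<sim>[sequentially] (\<lambda>n. c / D n)"
      by (rule asymp_equiv_of_tendsto_div[OF _ c'(1) zero_less_one D])
  }
qed

text \<open>The primitive of \<open>exp (- Lambda_int)\<close> is \<open>iter_log (Suc k)\<close>
  for \<open>B = 1\<close> and otherwise a multiple of a power of \<open>iter_log k\<close>. It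
  diverges for \<open>B \<le> 1\<close> and converges for \<open>1 < B\<close>.\<close>

lemma max_prob_asymp_plus:
  assumes Y0: "AE \<omega> in N. Y 0 \<omega> = 2"
    and q: "\<And>i. 2 \<le> i \<Longrightarrow> q i = 2 / 3 + pert (Suc k) B i"
  shows "B = 1 \<Longrightarrow> \<exists>c>0. max_prob N Y \<sim>[sequentially]
      (\<lambda>n. c / ((\<Prod>j<k. iter_log j (real n)) * iter_log k (real n) * (iter_log (Suc k) (real n))\<^sup>2))"
    and "1 < B \<Longrightarrow> \<exists>c>0. max_prob N Y \<sim>[sequentially]
      (\<lambda>n. c / ((\<Prod>j<k. iter_log j (real n)) * iter_log k (real n) powr B))"
    and "B < 1 \<Longrightarrow> \<exists>c>0. max_prob N Y \<sim>[sequentially]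
      (\<lambda>n. c / ((\<Prod>j<k. iter_log j (real n)) * iter_log k (real n) powr (2 - B)))"
proof -
  have incr: "\<exists>c>0. (\<lambda>n. scale_incr (\<lambda>i. p i / q i) n / exp (- Lambda_int k B (real n))) \<longlonglongrightarrow> c"
    using scale_incr_pert_asymp[of 1 k B] q by simp
  {
    assume B: "B = 1"
    show "\<exists>c>0. max_prob N Y \<sim>[sequentially]
      (\<lambda>n. c / ((\<Prod>j<k. iter_log j (real n)) * iter_log k (real n) * (iter_log (Suc k) (real n))\<^sup>2))"
    proof (rule max_prob_asymp_at_top[OF Y0 incr DERIV_iter_log_Suc[of k] _ DERIV_minus_Lambda_int
          minus_Lambda_real_tendsto_0 filterlim_iter_log _ zero_less_one])
      have "\<forall>\<^sub>F x in at_top. 1 = iter_log_weight k x / exp (- Lambda_int k B x)"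
        using exp_minus_Lambda_int_1[of k] unfolding B
      proof eventually_elim
        case (elim x)
        show ?case unfolding elim[symmetric] by simp
      qed
      then show "((\<lambda>x. iter_log_weight k x / exp (- Lambda_int k B x)) \<longlongrightarrow> 1) at_top"
        by (rule Lim_transform_eventually[OF tendsto_const])
      have "((\<lambda>x. iter_log_weight k x * (1 / iter_log (Suc k) x)) \<longlongrightarrow> 0 * 0) at_top"
        by (intro tendsto_mult iter_log_weight_tendsto_0
            filterlim_compose[OF one_div_tendsto_0_at_top filterlim_iter_log])
      moreover have "\<forall>\<^sub>F x in at_top. iter_log_weight k x * (1 / iter_log (Suc k) x) =
          exp (- Lambda_int k B x) / iter_log (Suc k) x"
        using exp_minus_Lambda_int_1[of k] by eventually_elim (simp add: B)
      ultimately show "((\<lambda>x. exp (- Lambda_int k B x) / iter_log (Suc k) x) \<longlongrightarrow> 0) at_top"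
        using Lim_transform_eventually by fastforce
      show "\<forall>\<^sub>F n in sequentially. exp (- Lambda_int k B (real n)) / (iter_log (Suc k) (real n))\<^sup>2 =
          1 / ((\<Prod>j<k. iter_log j (real n)) * iter_log k (real n) * (iter_log (Suc k) (real n))\<^sup>2)"
        using eventually_real_sequentially[OF exp_minus_Lambda_int_1[of k]]
        by eventually_elim (simp add: B iter_log_weight_def lessThan_Suc_atMost[symmetric])
    qed
  }
  {
    assume B: "1 < B"
    have "((\<lambda>x. iter_log k x powr (1 - B) / (1 - B)) \<longlongrightarrow> 0 / (1 - B)) at_top"
      using B by (intro tendsto_divide tendsto_const tendsto_neg_powr filterlim_iter_log) auto
    then show "\<exists>c>0. max_prob N Y \<sim>[sequentially]
      (\<lambda>n. c / ((\<Prod>j<k. iter_log j (real n)) * iter_log k (real n) powr B))"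
      using B by (intro max_prob_asymp_convergent[OF Y0 incr DERIV_iter_log_powr[of B k] _ DERIV_minus_Lambda_int
          minus_Lambda_real_tendsto_0] eventually_real_sequentially[OF exp_minus_Lambda_int]) auto
  }
  {
    assume B: "B < 1"
    show "\<exists>c>0. max_prob N Y \<sim>[sequentially]
      (\<lambda>n. c / ((\<Prod>j<k. iter_log j (real n)) * iter_log k (real n) powr (2 - B)))"
    proof (rule max_prob_asymp_at_top[OF Y0 incr DERIV_iter_log_powr[of B k] _ DERIV_minus_Lambda_int
          minus_Lambda_real_tendsto_0])
      have "filterlim (\<lambda>x. inverse (1 - B) * iter_log k x powr (1 - B)) at_top at_top"
        using B by (intro filterlim_tendsto_pos_mult_at_top[OF tendsto_const] filterlim_iter_log_powr) auto
      then show "filterlim (\<lambda>x. iter_log k x powr (1 - B) / (1 - B)) at_top at_top"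
        by (simp add: divide_inverse mult.commute)
      have "((\<lambda>x. (1 - B) * iter_log_weight k x) \<longlongrightarrow> (1 - B) * 0) at_top"
        by (intro tendsto_intros iter_log_weight_tendsto_0)
      then have "((\<lambda>x. (1 - B) * iter_log_weight k x) \<longlongrightarrow> 0) at_top" by simp
      moreover have "\<forall>\<^sub>F x in at_top. (1 - B) * iter_log_weight k x =
          exp (- Lambda_int k B x) / (iter_log k x powr (1 - B) / (1 - B))"
        using exp_minus_Lambda_int[of k B] eventually_iter_log_ge[of k 1]
      proof eventually_elim
        case (elim x)
        define L where "L = iter_log k x"
        have "0 < L" using elim(2) unfolding L_def by fastforce
        then have "L powr B * L powr (1 - B) = L" by (simp flip: powr_add)
        then have "(1 - B) * iter_log_weight k x =
            (1 - B) / ((\<Prod>j<k. iter_log j x) * (L powr B * L powr (1 - B)))"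
          by (simp add: iter_log_weight_def lessThan_Suc_atMost[symmetric] L_def)
        then show ?case unfolding elim(1) L_def[symmetric] by simp
      qed
      ultimately show "((\<lambda>x. exp (- Lambda_int k B x) / (iter_log k x powr (1 - B) / (1 - B))) \<longlongrightarrow> 0) at_top"
        by (rule Lim_transform_eventually)
      show "\<forall>\<^sub>F n in sequentially. exp (- Lambda_int k B (real n)) / (iter_log k (real n) powr (1 - B) / (1 - B))\<^sup>2 =
          (1 - B)\<^sup>2 / ((\<Prod>j<k. iter_log j (real n)) * iter_log k (real n) powr (2 - B))"
        using eventually_real_sequentially[OF exp_minus_Lambda_int[of k B]]
          eventually_real_sequentially[OF eventually_iter_log_ge[of k 1]]
      proof eventually_elim
        case (elim n)
        define L where "L = iter_log k (real n)"
        have "0 < L" using elim(2) unfolding L_def by fastforce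
        \<comment> \<open>One factor comes from the increment and two from the square of the
          primitive: \<open>B + 2 * (1 - B) = 2 - B\<close>.\<close>
        then have L: "L powr B * (L powr (1 - B))\<^sup>2 = L powr (2 - B)"
          by (simp add: power2_eq_square flip: powr_add)
        show ?case unfolding elim(1) L_def[symmetric] L[symmetric] by (simp add: power_divide)
      qed
    qed (use B in auto)
  }
qed

text \<open>With \<open>E = exp (Lambda_int k B n)\<close> the scale function is of order
  \<open>n * E / 2\<close>, which yields \<open>4 / (n ^ 2 * E)\<close>; the factor \<open>n\<close>
  contained in \<open>E\<close> completes the cube.\<close>

lemma max_prob_asymp_minus:
  assumes Y0: "AE \<omega> in N. Y 0 \<omega> = 2"
    and q: "\<And>i. 2 \<le> i \<Longrightarrow> q i = 2 / 3 - pert (Suc k) B i" and "0 < k"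
  shows "\<exists>c>0. max_prob N Y \<sim>[sequentially]
    (\<lambda>n. c / (real n ^ 3 * (\<Prod>j\<in>{1..<k}. iter_log j (real n)) * iter_log k (real n) powr B))"
proof (rule max_prob_asymp_at_top[OF Y0 _ DERIV_mult_exp_Lambda_int[of k B] _ DERIV_Lambda_int
      Lambda_real_tendsto_0 filterlim_mult_exp_Lambda_int[OF \<open>0 < k\<close>]])
  show "\<exists>c>0. (\<lambda>n. scale_incr (\<lambda>i. p i / q i) n / exp (Lambda_int k B (real n))) \<longlonglongrightarrow> c"
    using scale_incr_pert_asymp[of "-1" k B] q by simp
  have "((\<lambda>x. (1 + x * Lambda_real k B x) / 2) \<longlongrightarrow> (1 + 1) / 2) at_top"
    by (intro tendsto_intros mult_Lambda_real_tendsto_1 \<open>0 < k\<close>) simp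
  then show "((\<lambda>x. exp (Lambda_int k B x) * (1 + x * Lambda_real k B x) / 2 / exp (Lambda_int k B x)) \<longlongrightarrow> 1) at_top"
    by simp
  have "((\<lambda>x::real. 2 * (1 / x)) \<longlongrightarrow> 2 * 0) at_top"
    by (intro tendsto_intros one_div_tendsto_0_at_top)
  then show "((\<lambda>x. exp (Lambda_int k B x) / (x * exp (Lambda_int k B x) / 2)) \<longlongrightarrow> 0) at_top"
    by simp
  show "(0::real) < 4" by simp
  show "\<forall>\<^sub>F n in sequentially. exp (Lambda_int k B (real n)) / (real n * exp (Lambda_int k B (real n)) / 2)\<^sup>2 =
      4 / (real n ^ 3 * (\<Prod>j\<in>{1..<k}. iter_log j (real n)) * iter_log k (real n) powr B)"
    using eventually_real_sequentially[OF exp_Lambda_int[of k B]] eventually_gt_at_top[of 0]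
  proof eventually_elim
    case (elim n)
    define E where "E = exp (Lambda_int k B (real n))"
    have "{..<k} = insert 0 {1..<k}" using \<open>0 < k\<close> by auto
    then have E: "E = real n * (\<Prod>j\<in>{1..<k}. iter_log j (real n)) * iter_log k (real n) powr B"
      using elim(1) by (simp add: E_def)
    have "E \<noteq> 0" by (simp add: E_def)
    then have "E / (real n * E / 2)\<^sup>2 = 4 / (real n ^ 2 * E)"
      using elim(2) by (simp add: field_simps power2_eq_square)
    also have "real n ^ 2 * E = real n ^ 3 * (\<Prod>j\<in>{1..<k}. iter_log j (real n)) * iter_log k (real n) powr B"
      unfolding E by (simp add: power2_eq_square power3_eq_cube mult_ac)
    finally show ?case by (simp add: E_def)
  qed
qed

text \<open>\<open>Lambda 1 i B = B / i\<close> is odd in \<open>B\<close>, and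
  \<open>start_index\<close> sees only its absolute value.\<close>

lemma pert_1_minus: "pert 1 (- B) i = - pert 1 B i"
proof -
  have L: "Lambda 1 n (- B) = - Lambda 1 n B" for n by (simp add: Lambda_def)
  have "start_index 1 (- B) = start_index 1 B" unfolding start_index_def L abs_minus_cancel ..
  then show ?thesis by (simp only: pert_def L minus_divide_left)
qed

end

theorem theorem2:
  fixes K :: nat and B :: real
    and N :: "'a measure" and Y :: "nat \<Rightarrow> 'a \<Rightarrow> nat" and q p :: "nat \<Rightarrow> real"
  assumes "1 \<le> K"
    and "two_one_walk N Y q p"
    and "AE \<omega> in N. Y 0 \<omega> = 2"
  shows
    "((\<forall>i\<ge>2. q i = 2 / 3 + pert K B i) \<longrightarrow>
        (B = 1 \<longrightarrow> (\<exists>c>0. max_prob N Y \<sim>[sequentially]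
           (\<lambda>n. c / ((\<Prod>j<K - 1. iter_log j (real n)) * iter_log (K - 1) (real n)
                      * (iter_log K (real n))\<^sup>2)))) \<and>
        (B > 1 \<longrightarrow> (\<exists>c>0. max_prob N Y \<sim>[sequentially]
           (\<lambda>n. c / ((\<Prod>j<K - 1. iter_log j (real n)) * iter_log (K - 1) (real n) powr B)))) \<and>
        (B < 1 \<longrightarrow> (\<exists>c>0. max_prob N Y \<sim>[sequentially]
           (\<lambda>n. c / ((\<Prod>j<K - 1. iter_log j (real n)) * iter_log (K - 1) (real n) powr (2 - B))))))
     \<and>
     ((\<forall>i\<ge>2. q i = 2 / 3 - pert K B i) \<longrightarrow>
        (K = 1 \<and> B > -1 \<longrightarrow> (\<exists>c>0. max_prob N Y \<sim>[sequentially]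
           (\<lambda>n. c / real n powr (B + 2)))) \<and>
        (K = 1 \<and> B = -1 \<longrightarrow> (\<exists>c>0. max_prob N Y \<sim>[sequentially]
           (\<lambda>n. c / (real n * (ln (real n))\<^sup>2)))) \<and>
        (K = 1 \<and> B < -1 \<longrightarrow> (\<exists>c>0. max_prob N Y \<sim>[sequentially]
           (\<lambda>n. c * real n powr B))) \<and>
        (K > 1 \<longrightarrow> (\<exists>c>0. max_prob N Y \<sim>[sequentially]
           (\<lambda>n. c / (real n ^ 3 * (\<Prod>j\<in>{1..<K - 1}. iter_log j (real n))
                      * iter_log (K - 1) (real n) powr B)))))"
proof -
  interpret two_one_walk N Y q p by fact
  obtain k where K: "K = Suc k" using assms(1) by (cases K) auto
  note plus = max_prob_asymp_plus[OF assms(3)] and minus = max_prob_asymp_minus[OF assms(3)]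
  show ?thesis
  proof (intro conjI impI, goal_cases)
    case 1
    then show ?case using plus(1)[of k B] by (simp add: K)
  next
    case 2
    then show ?case using plus(2)[of k B] by (simp add: K)
  next
    case 3
    then show ?case using plus(3)[of k B] by (simp add: K)
  next
    case 4 \<comment> \<open>For \<open>K = 1\<close>, part (ii) is part (i) with \<open>- B\<close> in place of \<open>B\<close>.\<close>
    then have "q i = 2 / 3 + pert (Suc 0) (- B) i" if "2 \<le> i" for i
      using that pert_1_minus[of B i] by simp
    \<comment> \<open>The product over \<open>j < 0\<close> is empty, \<open>iter_log 0 n\<close> is
      \<open>n\<close>, and the exponent is \<open>2 - (- B)\<close>.\<close>
    then show ?case using plus(3)[of 0 "- B"] 4 by (simp add: add.commute)
  next
    case 5
    then have "q i = 2 / 3 + pert (Suc 0) (- B) i" if "2 \<le> i" for i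
      using that pert_1_minus[of B i] by simp
    then show ?case using plus(1)[of 0 "- B"] 5 by (simp add: iter_log_Suc)
  next
    case 6
    then have "q i = 2 / 3 + pert (Suc 0) (- B) i" if "2 \<le> i" for i
      using that pert_1_minus[of B i] by simp
    then show ?case using plus(2)[of 0 "- B"] 6 by (simp add: powr_minus_divide)
  next
    case 7
    then show ?case using minus[of k B] by (simp add: K)
  qed
qed

end
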